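(* For every integer $n\ge 1$, the positively elliptic region $\mathrm{Sp}_{\mathrm{ell}}^+(2n)$, an open subset of $\mathrm{Sp}(2n)$ equipped with the restriction of the cone structure $C$ on $\mathrm{Sp}(2n)$, is globally hyperbolic.
   Context: Let $\omega=\sum_{i=1}^n dx_i\wedge dy_i$ be the canonical symplectic form on $\mathbb{R}^{2n}$ and $\mathrm{Sp}(2n)$ the Lie group of linear maps of $\mathbb{R}^{2n}$ preserving $\omega$, with Lie algebra $\mathfrak{sp}(2n)=\{X\in \mathrm{Mat}(2n,\mathbb{R}) : \omega(\cdot,X\cdot)\text{ is symmetric}\}$. Cone structure: $C(id)=\{X\in\mathfrak{sp}(2n)\setminus\{0\} : \omega(\cdot,X\cdot)\text{ is positive semi-definite}\}$, and $C(W)=W\,C(id)=C(id)\,W\subset T_W\mathrm{Sp}(2n)$ for $W\in\mathrm{Sp}(2n)$; $C=\bigcup_W C(W)\subset T\mathrm{Sp}(2n)$. A smooth curve $\gamma$ is causal if $\gamma'(t)\in C(\gamma(t))$ for all $t$. Positively elliptic region: extend $\omega$ to a skew-Hermitian form on $\mathbb{C}^{2n}$ (linear in the first, antilinear in the second argument), and let $\kappa=-i\omega$ be the Krein form. $\mathrm{Sp}_{\mathrm{ell}}^+(2n)$ is the set of $W\in\mathrm{Sp}(2n)$ all of whose complex eigenvalues lie in $S^1\setminus\{\pm1\}$ and such that, for eigenvalues $\lambda$ of $W$, $\kappa$ is positive definite on the generalised eigenspace $E_\lambda\subset\mathbb{C}^{2n}$ if and only if $\lambda$ has positive imaginary part.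 Equivalently, $W\in \mathrm{Sp}_{\mathrm{ell}}^+(2n)$ iff there are an $\omega$-orthogonal splitting of $\mathbb{R}^{2n}$ into symplectic planes $V_1,\dots,V_n$, complex structures $J_k$ on $V_k$ that are $\omega$-compatible (i.e. $\omega(\cdot,J_k\cdot)$ is a positive definite inner product on $V_k$), and $\theta_k\in(0,\pi)$ with $W=\bigoplus_{k=1}^n e^{\theta_kJ_k}$. Global hyperbolicity: for a manifold $M$ with cone structure $C$, and $p\in M$, let $J^+(p)$ (resp. $J^-(p)$) be the set consisting of $p$ and all $q\in M$ such that there is a causal curve in $M$ from $p$ to $q$ (resp. from $q$ to $p$). $(M,C)$ is causal if there is no closed causal curve in $M$. $(M,C)$ is globally hyperbolic if it is causal and $J^+(p)\cap J^-(q)$ is compact for all $p,q\in M$. For $M=\mathrm{Sp}_{\mathrm{ell}}^+(2n)$ all causal curves and the sets $J^\pm$ are taken inside $\mathrm{Sp}_{\mathrm{ell}}^+(2n)$. *)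

theory Defs
  imports "HOL-Analysis.Analysis"
begin

section \<open>Manifolds with a cone structure\<close>

text \<open>
  A manifold is a subset \<open>M\<close> of a normed space (an open subset of an embedded submanifold),
  and a cone structure is given by the sets \<open>C p\<close> of tangent vectors at \<open>p \<in> M\<close>, seen as
  vectors of the ambient space. Only the values of \<open>C\<close> on \<open>M\<close> matter, so that the same \<open>C\<close>
  also denotes its restriction to any smaller set.
\<close>

text \<open>\<open>D k\<close> is the \<open>k\<close>-th derivative of \<open>\<gamma>\<close>; it is one-sided at the end points.\<close>

definition smooth_curve_on :: "(real \<Rightarrow> 'a::real_normed_vector) \<Rightarrow> real \<Rightarrow> real \<Rightarrow> bool" where
  "smooth_curve_on \<gamma> a b \<longleftrightarrow>
     (\<exists>D :: nat \<Rightarrow> real \<Rightarrow> 'a. D 0 = \<gamma> \<and>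
        (\<forall>k. \<forall>t\<in>{a..b}. (D k has_vector_derivative D (Suc k) t) (at t within {a..b})))"

definition causal_curve ::
  "'a::real_normed_vector set \<Rightarrow> ('a \<Rightarrow> 'a set) \<Rightarrow> (real \<Rightarrow> 'a) \<Rightarrow> real \<Rightarrow> real \<Rightarrow> bool" where
  "causal_curve M C \<gamma> a b \<longleftrightarrow>
     a < b \<and> smooth_curve_on \<gamma> a b \<and> \<gamma> ` {a..b} \<subseteq> M \<and>
     (\<forall>t\<in>{a..b}. vector_derivative \<gamma> (at t within {a..b}) \<in> C (\<gamma> t))"

definition causal_future ::
  "'a::real_normed_vector set \<Rightarrow> ('a \<Rightarrow> 'a set) \<Rightarrow> 'a \<Rightarrow> 'a set" where
  "causal_future M C p = {p} \<union> {q\<in>M. \<exists>\<gamma> a b. causal_curve M C \<gamma> a b \<and> \<gamma> a = p \<and> \<gamma> b = q}"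

definition causal_past ::
  "'a::real_normed_vector set \<Rightarrow> ('a \<Rightarrow> 'a set) \<Rightarrow> 'a \<Rightarrow> 'a set" where
  "causal_past M C p = {p} \<union> {q\<in>M. \<exists>\<gamma> a b. causal_curve M C \<gamma> a b \<and> \<gamma> a = q \<and> \<gamma> b = p}"

text \<open>
  A closed curve need not close up smoothly at its base point, so that causality also excludes
  closed curves with a corner there.
\<close>

definition causal :: "'a::real_normed_vector set \<Rightarrow> ('a \<Rightarrow> 'a set) \<Rightarrow> bool" where
  "causal M C \<longleftrightarrow> \<not> (\<exists>\<gamma> a b. causal_curve M C \<gamma> a b \<and> \<gamma> a = \<gamma> b)"

definition globally_hyperbolic :: "'a::real_normed_vector set \<Rightarrow> ('a \<Rightarrow> 'a set) \<Rightarrow> bool" where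
  "globally_hyperbolic M C \<longleftrightarrow>
     causal M C \<and> (\<forall>p\<in>M. \<forall>q\<in>M. compact (causal_future M C p \<inter> causal_past M C q))"


section \<open>The symplectic group and its cone structure\<close>

text \<open>
  The index type \<open>'n + 'n\<close> has \<open>2n\<close> elements, where \<open>n = CARD('n) \<ge> 1\<close>: the coordinates
  \<open>x\<^sub>i\<close> and \<open>y\<^sub>i\<close> have the indices \<open>Inl i\<close> and \<open>Inr i\<close>.
\<close>

type_synonym 'n mat2n = "real ^ ('n + 'n) ^ ('n + 'n)"

definition symplectic_form :: "real ^ ('n::finite + 'n) \<Rightarrow> real ^ ('n + 'n) \<Rightarrow> real" where
  "symplectic_form u v = (\<Sum>i\<in>UNIV. u $ Inl i * v $ Inr i - u $ Inr i * v $ Inl i)"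

definition Sp :: "'n::finite mat2n set" where
  "Sp = {W. \<forall>u v. symplectic_form (W *v u) (W *v v) = symplectic_form u v}"

definition sp_algebra :: "'n::finite mat2n set" where
  "sp_algebra = {X. \<forall>u v. symplectic_form u (X *v v) = symplectic_form v (X *v u)}"

definition sp_cone_id :: "'n::finite mat2n set" where
  "sp_cone_id = {X \<in> sp_algebra - {0}. \<forall>v. 0 \<le> symplectic_form v (X *v v)}"

text \<open>
  Conjugation with a symplectic matrix preserves \<open>sp_cone_id\<close>, so that left and right translation
  yield the same cone.
\<close>

definition sp_cone :: "'n::finite mat2n \<Rightarrow> 'n mat2n set" where
  "sp_cone W = (\<lambda>X. W ** X) ` sp_cone_id"


section \<open>The positively elliptic region\<close>

definition symplectic_form_complex :: "complex ^ ('n::finite + 'n) \<Rightarrow> complex ^ ('n + 'n) \<Rightarrow> complex" where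
  "symplectic_form_complex u v =
     (\<Sum>i\<in>UNIV. u $ Inl i * cnj (v $ Inr i) - u $ Inr i * cnj (v $ Inl i))"

definition krein_form :: "complex ^ ('n::finite + 'n) \<Rightarrow> complex ^ ('n + 'n) \<Rightarrow> complex" where
  "krein_form u v = - \<i> * symplectic_form_complex u v"

lemma krein_form_hermitian: "krein_form v u = cnj (krein_form u v)"
  by (simp add: krein_form_def symplectic_form_complex_def sum_distrib_left algebra_simps)

text \<open>As the Krein form is Hermitian, \<open>krein_form v v\<close> is real.\<close>

definition krein_positive_definite_on :: "(complex ^ ('n::finite + 'n)) set \<Rightarrow> bool" where
  "krein_positive_definite_on V \<longleftrightarrow> (\<forall>v \<in> V - {0}. 0 < Re (krein_form v v))"

definition complexify :: "'n::finite mat2n \<Rightarrow> complex ^ ('n + 'n) ^ ('n + 'n)" where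
  "complexify W = map_matrix complex_of_real W"

definition complex_eigenvalue :: "'n::finite mat2n \<Rightarrow> complex \<Rightarrow> bool" where
  "complex_eigenvalue W \<mu> \<longleftrightarrow> (\<exists>v. v \<noteq> 0 \<and> complexify W *v v = \<mu> *s v)"

definition generalised_eigenspace :: "'n::finite mat2n \<Rightarrow> complex \<Rightarrow> (complex ^ ('n + 'n)) set" where
  "generalised_eigenspace W \<mu> = {v. \<exists>k. ((\<lambda>u. complexify W *v u - \<mu> *s u) ^^ k) v = 0}"

definition Sp_ell_pos :: "'n::finite mat2n set" where
  "Sp_ell_pos = {W \<in> Sp. \<forall>\<mu>. complex_eigenvalue W \<mu> \<longrightarrow>
     \<mu> \<in> sphere 0 1 - {1, -1} \<and>
     (krein_positive_definite_on (generalised_eigenspace W \<mu>) \<longleftrightarrow> 0 < Im \<mu>)}"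

end

theory Submission
  imports Defs "HOL-Computational_Algebra.Fundamental_Theorem_Algebra"
begin

text \<open>
  The Cayley transform \<open>X = (W - 1) (W + 1)\<^sup>-\<^sup>1\<close> identifies the positively elliptic region with an open
  convex cone in the vector space \<open>sp_algebra\<close>, in such a way that the cone structure becomes
  constant. Global hyperbolicity then reduces to the compactness of order intervals.

  The region has a description that does not mention eigenvalues: \<open>W \<in> Sp\<close> is positively elliptic
  if and only if \<open>\<omega>(u, W u) > 0\<close> for all real \<open>u \<noteq> 0\<close>; the set of these \<open>W\<close> is called \<open>Sp_pos\<close>. For
  an eigenvector \<open>u\<close> with \<open>W u = \<mu> u\<close> the Hermitian extension gives
  \<open>Re \<omega>(u, W u) = Im \<mu> \<cdot> \<kappa>(u, u)\<close>, so that positivity of the form means precisely that \<open>\<kappa>\<close> has the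
  sign of \<open>Im \<mu>\<close> on eigenvectors. Then no eigenvector is \<open>\<kappa>\<close>-isotropic, which excludes Jordan
  blocks (\<open>jordan_block_isotropic\<close>). Hence generalised eigenspaces are eigenspaces, which yields
  one inclusion (\<open>Sp_pos_subset_Sp_ell_pos\<close>), and every complex vector is a sum of eigenvectors,
  which are \<open>\<omega>\<close>-orthogonal for different eigenvalues, which yields the other
  (\<open>Sp_ell_pos_subset_Sp_pos\<close>). Openness in \<open>Sp\<close> is visible from this description, because
  positivity has to be tested on the compact unit sphere only.

  Writing \<open>v = (W + 1) u\<close> one finds \<open>\<omega>(v, X v) = 2 \<omega>(u, W u)\<close>. Therefore \<open>W \<mapsto> X\<close> is a bijection
  from the region onto the set \<open>sp_cone_interior\<close> of all \<open>X \<in> sp_algebra\<close> with positive definite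
  \<open>\<omega>(\<cdot>, X \<cdot>)\<close>. If \<open>W\<close> moves with velocity \<open>W A\<close>, then \<open>X\<close> moves with velocity
  \<open>2 (W + 1)\<^sup>-\<^sup>1 W A (W + 1)\<^sup>-\<^sup>1\<close>, whose form is that of \<open>A\<close> up to a congruence and a factor \<open>2\<close>
  (\<open>cayley_differential_form\<close>). So the cone at every point is carried to the fixed cone
  \<open>sp_cone_id\<close> of positive semidefinite forms.

  Along a causal curve the form of \<open>X\<close> therefore increases in the Loewner order, and it does not
  return to its initial value; conversely, if \<open>X \<le> Y\<close> and \<open>X \<noteq> Y\<close>, the segment from \<open>X\<close> to \<open>Y\<close> is
  a causal curve. It follows that there are no closed causal curves, and that a causal diamond is
  the continuous image of a Loewner interval \<open>{X. P \<le> X \<le> Q}\<close>. Such an interval is compact, as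
  polarisation bounds all matrix entries, and it stays inside the open cone since \<open>P\<close> does.
\<close>

section \<open>Inversion of real matrices\<close>

lemma bounded_bilinear_matrix_matrix_mult:
  "bounded_bilinear ((**) :: real^'n::finite^'m::finite \<Rightarrow> real^'p::finite^'n \<Rightarrow> real^'p^'m)"
  unfolding bilinear_conv_bounded_bilinear[symmetric] bilinear_def
  by (auto intro!: linearI simp: matrix_add_ldistrib matrix_matrix_mult_def vec_eq_iff
      algebra_simps sum.distrib sum_distrib_left)

interpretation mat_mult: bounded_bilinear
  "(**) :: real^'n::finite^'n \<Rightarrow> real^'n^'n \<Rightarrow> real^'n^'n"
  by (rule bounded_bilinear_matrix_matrix_mult)

lemma bounded_bilinear_matrix_vector_mult:
  "bounded_bilinear ((*v) :: real^'n::finite^'m::finite \<Rightarrow> real^'n \<Rightarrow> real^'m)"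
  unfolding bilinear_conv_bounded_bilinear[symmetric] bilinear_def
  by (auto intro!: linearI simp: matrix_vector_mult_def vec_eq_iff
      algebra_simps sum.distrib sum_distrib_left)

interpretation mat_vec: bounded_bilinear
  "(*v) :: real^'n::finite^'n \<Rightarrow> real^'n \<Rightarrow> real^'n"
  by (rule bounded_bilinear_matrix_vector_mult)

lemma invertible_if_ker_0:
  fixes A :: "real^'n::finite^'n"
  assumes "\<And>u. A *v u = 0 \<Longrightarrow> u = 0"
  shows "invertible A"
  using assms matrix_left_invertible_ker[of A] by (auto simp: invertible_left_inverse)

lemma matrix_inv_mult:
  fixes A :: "real^'n::finite^'n"
  assumes "invertible A"
  shows "A ** matrix_inv A = mat 1" "matrix_inv A ** A = mat 1"
  using someI_ex[OF assms[unfolded invertible_def]] by (auto simp: matrix_inv_def)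

lemma matrix_inv_eq:
  fixes A :: "real^'n::finite^'n"
  assumes "A ** B = mat 1"
  shows "matrix_inv A = B"
proof -
  have "invertible A" using assms invertible_right_inverse by blast
  then have "matrix_inv A ** (A ** B) = B" by (simp add: matrix_mul_assoc matrix_inv_mult)
  then show ?thesis using assms by simp
qed

lemma invertible_surj:
  fixes A :: "real^'n::finite^'n"
  assumes "invertible A" obtains u where "v = A *v u"
proof
  show "v = A *v (matrix_inv A *v v)"
    using assms by (simp add: matrix_vector_mul_assoc matrix_inv_mult)
qed

text \<open>By Cramer's rule the entries of the inverse are rational functions of the entries of the
  matrix; this is where the continuity of matrix inversion comes from.\<close>

lemma matrix_inv_component:
  fixes A :: "real^'n::finite^'n"
  assumes "invertible A"
  shows "matrix_inv A $ k $ j =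
    det (\<chi> i l. if l = k then axis j 1 $ i else A $ i $ l) / det A"
proof -
  have "A *v (matrix_inv A *v axis j 1) = axis j 1"
    using assms by (simp add: matrix_vector_mul_assoc matrix_inv_mult)
  then have "matrix_inv A *v axis j 1 =
      (\<chi> k. det (\<chi> i l. if l = k then axis j 1 $ i else A $ i $ l) / det A)"
    using assms by (subst (asm) cramer) (simp_all add: invertible_det_nz)
  moreover have "(matrix_inv A *v axis j 1) $ k = matrix_inv A $ k $ j"
    by (simp add: matrix_vector_mult_basis column_def)
  ultimately show ?thesis by simp
qed

lemma continuous_on_matrix_inv:
  "continuous_on {A :: real^'n::finite^'n. invertible A} matrix_inv"
proof -
  have entry: "continuous_on S (\<lambda>A. if b then c else A $ i $ l :: real)"
    for S :: "(real^'n^'n) set" and b c i l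
    by (cases b) (auto intro!: continuous_intros)
  have "continuous_on {A. invertible A} (\<lambda>A :: real^'n^'n. \<chi> k j.
      det (\<chi> i l. if l = k then axis j 1 $ i else A $ i $ l) / det A)"
    unfolding invertible_det_nz
    by (intro continuous_on_vec_lambda continuous_on_divide)
      (auto simp: det_def intro!: continuous_intros entry)
  then show ?thesis
    by (rule continuous_on_eq) (simp add: vec_eq_iff matrix_inv_component)
qed

lemma has_vector_derivative_iff_quotient:
  fixes f :: "real \<Rightarrow> 'a::real_normed_vector"
  shows "(f has_vector_derivative f') (at t within S) \<longleftrightarrow>
    ((\<lambda>s. (f s - f t) /\<^sub>R (s - t)) \<longlongrightarrow> f') (at t within S)"
proof -
  have eq: "norm ((1 / norm (s - t)) *\<^sub>R (f s - (f t + (s - t) *\<^sub>R f'))) =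
      norm ((f s - f t) /\<^sub>R (s - t) - f')" if "s \<noteq> t" for s
  proof -
    have "(f s - f t) /\<^sub>R (s - t) - f' = (1 / (s - t)) *\<^sub>R (f s - f t - (s - t) *\<^sub>R f')"
      using that unfolding scaleR_diff_right[of _ "f s - f t"] by (simp add: divide_inverse)
    then show ?thesis by (simp add: diff_diff_eq)
  qed
  have "(f has_vector_derivative f') (at t within S) \<longleftrightarrow>
      ((\<lambda>s. (1 / norm (s - t)) *\<^sub>R (f s - (f t + (s - t) *\<^sub>R f'))) \<longlongrightarrow> 0) (at t within S)"
    by (simp add: has_vector_derivative_def has_derivative_within bounded_linear_scaleR_left)
  also have "\<dots> \<longleftrightarrow> ((\<lambda>s. norm ((f s - f t) /\<^sub>R (s - t) - f')) \<longlongrightarrow> 0) (at t within S)"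
    unfolding tendsto_norm_zero_iff[symmetric, where f = "\<lambda>s. (1 / norm (s - t)) *\<^sub>R _ s"]
    by (intro filterlim_cong refl eventually_mono[OF _ eq]) (auto simp: eventually_at_filter)
  also have "\<dots> \<longleftrightarrow> ((\<lambda>s. (f s - f t) /\<^sub>R (s - t)) \<longlongrightarrow> f') (at t within S)"
    by (simp add: tendsto_norm_zero_iff LIM_zero_iff)
  finally show ?thesis .
qed

text \<open>The difference quotient of \<open>A\<^sup>-\<^sup>1\<close> is
  \<open>- A(s)\<^sup>-\<^sup>1 ((A(s) - A(t)) / (s - t)) A(t)\<^sup>-\<^sup>1\<close>, so that continuity of the inverse suffices.\<close>

lemma has_vector_derivative_matrix_inv:
  fixes A :: "real \<Rightarrow> real^'n::finite^'n"
  assumes der: "(A has_vector_derivative A') (at t within S)" and t: "t \<in> S"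
    and inv: "\<And>s. s \<in> S \<Longrightarrow> invertible (A s)"
  shows "((\<lambda>s. matrix_inv (A s)) has_vector_derivative
      - (matrix_inv (A t) ** A' ** matrix_inv (A t))) (at t within S)"
proof -
  let ?R = "\<lambda>s. matrix_inv (A s)"
  have A: "(A \<longlongrightarrow> A t) (at t within S)"
    using has_vector_derivative_continuous[OF der] by (simp add: continuous_within)
  have R: "(?R \<longlongrightarrow> ?R t) (at t within S)"
    by (rule continuous_on_tendsto_compose[OF continuous_on_matrix_inv A])
      (use inv t in \<open>auto simp: eventually_at_filter\<close>)
  have "((\<lambda>s. - (?R s ** ((A s - A t) /\<^sub>R (s - t)) ** ?R t)) \<longlongrightarrow>
      - (?R t ** A' ** ?R t)) (at t within S)"
    using der R unfolding has_vector_derivative_iff_quotient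
    by (intro tendsto_minus mat_mult.tendsto tendsto_const)
  moreover have "- (?R s ** ((A s - A t) /\<^sub>R (s - t)) ** ?R t) = (?R s - ?R t) /\<^sub>R (s - t)"
    if "s \<in> S" for s
  proof -
    have "?R s ** (A s - A t) ** ?R t = ?R s ** A s ** ?R t - ?R s ** (A t ** ?R t)"
      by (simp only: mat_mult.diff_left mat_mult.diff_right matrix_mul_assoc)
    also have "\<dots> = ?R t - ?R s"
      using inv[OF that] inv[OF t] by (simp add: matrix_inv_mult)
    finally show ?thesis
      by (simp add: mat_mult.scaleR_left mat_mult.scaleR_right flip: scaleR_minus_right)
  qed
  ultimately show ?thesis
    unfolding has_vector_derivative_iff_quotient
    by (auto elim!: Lim_transform_eventually simp: eventually_at_filter)
qed

section \<open>Symplectic linear algebra\<close>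

lemma bounded_bilinear_symplectic_form: "bounded_bilinear symplectic_form"
  unfolding bilinear_conv_bounded_bilinear[symmetric] bilinear_def
  by (auto intro!: linearI simp: symplectic_form_def 
      algebra_simps sum.distrib sum_subtractf sum_distrib_left)

interpretation symplectic_form: bounded_bilinear symplectic_form
  by (rule bounded_bilinear_symplectic_form)

lemma symplectic_form_skew: "symplectic_form v u = - symplectic_form u v"
  by (simp add: symplectic_form_def sum_negf[symmetric] algebra_simps)

lemma symplectic_form_self [simp]: "symplectic_form u u = 0"
  by (simp add: symplectic_form_def algebra_simps)

text \<open>Coordinates are pairings with basis vectors, up to sign. This gives nondegeneracy, and later
  turns bounds on the form of a matrix into bounds on its entries.\<close>

lemma symplectic_form_component:
  obtains e where "\<And>w. symplectic_form e w = w $ i"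
proof (cases i)
  case (Inl k)
  have "symplectic_form (- axis (Inr k) 1) w = w $ i" for w
  proof -
    have "symplectic_form (- axis (Inr k) 1) w = (\<Sum>l\<in>UNIV. if l = k then w $ Inl l else 0)"
      unfolding symplectic_form_def by (intro sum.cong) (auto simp: axis_def)
    then show ?thesis by (simp add: Inl)
  qed
  then show ?thesis by (rule that)
next
  case (Inr k)
  have "symplectic_form (axis (Inl k) 1) w = w $ i" for w
  proof -
    have "symplectic_form (axis (Inl k) 1) w = (\<Sum>l\<in>UNIV. if l = k then w $ Inr l else 0)"
      unfolding symplectic_form_def by (intro sum.cong) (auto simp: axis_def)
    then show ?thesis by (simp add: Inr)
  qed
  then show ?thesis by (rule that)
qed

lemma symplectic_form_nondegenerate:
  assumes "\<And>v. symplectic_form v w = 0" shows "w = 0"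
proof -
  have "w $ i = 0" for i
    using symplectic_form_component[of i] assms by metis
  then show ?thesis by (simp add: vec_eq_iff)
qed

lemma matrix_eq_0_if_form_0:
  assumes "\<And>v w. symplectic_form v (A *v w) = 0" shows "A = 0"
  using assms symplectic_form_nondegenerate by (metis matrix_eq matrix_vector_mult_0)

lemma sp_algebra_skew:
  assumes "X \<in> sp_algebra"
  shows "symplectic_form (X *v u) v = - symplectic_form u (X *v v)"
  using assms symplectic_form_skew[of v "X *v u"] by (auto simp: sp_algebra_def)

text \<open>For \<open>X \<in> sp_algebra\<close> the bilinear form \<open>\<omega>(\<cdot>, X \<cdot>)\<close> is symmetric, hence determined by its
  diagonal values.\<close>

lemma sp_algebra_polarisation:
  assumes "X \<in> sp_algebra"
  shows "symplectic_form u (X *v v) =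
    (symplectic_form (u + v) (X *v (u + v)) - symplectic_form (u - v) (X *v (u - v))) / 4"
proof -
  have "symplectic_form v (X *v u) = symplectic_form u (X *v v)"
    using assms by (auto simp: sp_algebra_def)
  then show ?thesis
    by (simp add: mat_vec.add_right mat_vec.diff_right symplectic_form.add_left
        symplectic_form.add_right symplectic_form.diff_left symplectic_form.diff_right)
qed

lemma Sp_invertible: "W \<in> Sp \<Longrightarrow> invertible W"
proof (rule invertible_if_ker_0)
  fix u assume "W \<in> Sp" "W *v u = 0"
  then have "symplectic_form v u = 0" for v
    by (metis (mono_tags, lifting) Sp_def mem_Collect_eq symplectic_form.zero_right)
  then show "u = 0" by (rule symplectic_form_nondegenerate)
qed

section \<open>Sums of eigenvectors of a complex matrix\<close>

text \<open>This is the vector \<open>p(A) v\<close>.\<close>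

definition poly_act :: "complex^'m::finite^'m \<Rightarrow> complex poly \<Rightarrow> complex^'m \<Rightarrow> complex^'m" where
  "poly_act A p v = (\<Sum>i\<le>degree p. coeff p i *s (((*v) A) ^^ i) v)"

lemma poly_act_eq_sum:
  assumes "degree p \<le> n"
  shows "poly_act A p v = (\<Sum>i\<le>n. coeff p i *s (((*v) A) ^^ i) v)"
  unfolding poly_act_def using assms
  by (intro sum.mono_neutral_left) (auto simp: coeff_eq_0)

lemma poly_act_linear_factor:
  "poly_act A ([:- \<mu>, 1:] * q) v = poly_act A q (A *v v - \<mu> *s v)"
proof -
  let ?x = "\<lambda>i. (((*v) A) ^^ i) v" and ?n = "degree q"
  have pow: "(((*v) A) ^^ i) (A *v v - \<mu> *s v) = ?x (Suc i) - \<mu> *s ?x i" for i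
    by (induction i) (simp_all add: matrix_vector_mult_diff_distrib vector_scalar_commute)
  have "[:- \<mu>, 1:] * q = pCons 0 q - smult \<mu> q"
    by simp
  moreover have "degree (pCons 0 q - smult \<mu> q) \<le> Suc ?n"
    by (intro degree_diff_le) (auto intro: degree_pCons_le order_trans[OF degree_smult_le])
  ultimately have "poly_act A ([:- \<mu>, 1:] * q) v =
      (\<Sum>i\<le>Suc ?n. coeff (pCons 0 q) i *s ?x i) - (\<Sum>i\<le>Suc ?n. (\<mu> * coeff q i) *s ?x i)"
    by (simp only: poly_act_eq_sum coeff_diff coeff_smult vector_sub_rdistrib sum_subtractf)
  also have "(\<Sum>i\<le>Suc ?n. coeff (pCons 0 q) i *s ?x i) = (\<Sum>i\<le>?n. coeff q i *s ?x (Suc i))"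
    by (subst sum.atMost_Suc_shift) simp
  also have "(\<Sum>i\<le>Suc ?n. (\<mu> * coeff q i) *s ?x i) = (\<Sum>i\<le>?n. (\<mu> * coeff q i) *s ?x i)"
    by (simp add: coeff_eq_0)
  also have "(\<Sum>i\<le>?n. coeff q i *s ?x (Suc i)) - \<dots> = poly_act A q (A *v v - \<mu> *s v)"
    by (simp add: poly_act_def pow sum_subtractf vector_ssub_ldistrib vector_smult_assoc mult.commute)
  finally show ?thesis .
qed

text \<open>The vectors \<open>v, A v, A\<^sup>2 v, \<dots>\<close> are linearly dependent. Dependence over the reals is enough,
  so the real dimension of the complex vector space bounds the number of powers needed.\<close>

lemma exists_annihilating_poly:
  fixes A :: "complex^'m::finite^'m"
  obtains p where "p \<noteq> 0" "poly_act A p v = 0"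
proof -
  let ?x = "\<lambda>i. (((*v) A) ^^ i) v" and ?n = "DIM(complex^'m)"
  have "\<exists>c :: nat \<Rightarrow> complex. (\<exists>i\<le>?n. c i \<noteq> 0) \<and> (\<Sum>i\<le>?n. c i *s ?x i) = 0"
    \<comment> \<open>Dependence is a notion for sets, so a repetition among the powers is a case of its own.\<close>
  proof (cases "inj_on ?x {..?n}")
    case False
    then obtain i j where ij: "i \<le> ?n" "j \<le> ?n" "i \<noteq> j" "?x i = ?x j"
      by (auto simp: inj_on_def)
    let ?c = "\<lambda>k. (if k = i then 1 else 0) - (if k = j then 1 else 0) :: complex"
    have "(\<Sum>k\<le>?n. ?c k *s ?x k) = (\<Sum>k\<le>?n. if k = i then ?x k else 0) - (\<Sum>k\<le>?n. if k = j then ?x k else 0)"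
      unfolding sum_subtractf[symmetric] by (intro sum.cong) (auto simp: vector_sub_rdistrib)
    also have "\<dots> = 0" using ij by simp
    finally show ?thesis using ij by (intro exI[of _ ?c]) auto
  next
    case True
    then have "card (?x ` {..?n}) > ?n"
      by (simp add: card_image del: DIM_cart)
    then have "dependent (?x ` {..?n})"
      by (intro dependent_biggerset) auto
    then obtain u where u: "\<exists>w\<in>?x ` {..?n}. u w \<noteq> 0" "(\<Sum>w\<in>?x ` {..?n}. u w *\<^sub>R w) = 0"
      by (auto simp: dependent_finite)
    have "complex_of_real r *s w = r *\<^sub>R w" for r and w :: "complex^'m"
      unfolding vec_eq_iff vector_smult_component vector_scaleR_component
      by (simp add: scaleR_conv_of_real)
    then have "(\<Sum>i\<le>?n. complex_of_real (u (?x i)) *s ?x i) = 0"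
      using u(2) by (simp add: sum.reindex[OF True] o_def del: DIM_cart)
    then show ?thesis
      using u(1) by (intro exI[of _ "\<lambda>i. complex_of_real (u (?x i))"]) auto
  qed
  then obtain c :: "nat \<Rightarrow> complex" and k where c: "k \<le> ?n" "c k \<noteq> 0" "(\<Sum>i\<le>?n. c i *s ?x i) = 0"
    by blast
  define p where "p = (\<Sum>i\<le>?n. monom (c i) i)"
  have coeff: "coeff p i = (if i \<le> ?n then c i else 0)" for i
    by (simp add: p_def coeff_sum sum.delta' del: DIM_cart)
  have "degree p \<le> ?n" by (rule degree_le) (simp add: coeff)
  then have "poly_act A p v = 0"
    using c(3) by (simp add: poly_act_eq_sum coeff del: DIM_cart)
  moreover have "p \<noteq> 0" using c(1,2) coeff[of k] by auto
  ultimately show ?thesis using that by blast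
qed

text \<open>
  The hypothesis says that \<open>A\<close> has no Jordan block of size two. Split a root \<open>\<mu>\<close> off the polynomial
  \<open>p\<close>; by induction \<open>(A - \<mu>) v\<close> is a sum of eigenvectors \<open>f l\<close>. Dividing those with \<open>l \<noteq> \<mu>\<close> by
  \<open>l - \<mu>\<close> gives a preimage \<open>w\<close> of their sum under \<open>A - \<mu>\<close>, so that \<open>A - \<mu>\<close> maps \<open>v - w\<close> to the
  remaining eigenvector \<open>f \<mu>\<close>, which has to vanish by hypothesis. The summands are indexed by
  eigenvalues, in order that different summands are orthogonal when \<open>A\<close> is symplectic.
\<close>

lemma poly_act_eq_0_imp_sum_eigenvectors:
  fixes A :: "complex^'m::finite^'m"
  assumes semisimple: "\<And>\<mu> u w. A *v u = \<mu> *s u \<Longrightarrow> A *v w = \<mu> *s w + u \<Longrightarrow> u = 0"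
    and "p \<noteq> 0" "poly_act A p v = 0"
  shows "\<exists>F f. finite F \<and> (\<forall>\<mu>. A *v f \<mu> = \<mu> *s f \<mu>) \<and> v = (\<Sum>\<mu>\<in>F. f \<mu>)"
  using assms(2,3)
proof (induction "degree p" arbitrary: p v)
  case 0
  then obtain c where "p = [:c:]" by (metis degree_eq_zeroE)
  with 0 have "v = 0" by (simp add: poly_act_def)
  then show ?case by (intro exI[of _ "{}"] exI[of _ "\<lambda>_. 0"]) simp
next
  case (Suc n)
  then have "\<not> constant (poly p)" by (simp add: constant_degree)
  then obtain \<mu> where "poly p \<mu> = 0"
    using fundamental_theorem_of_algebra by blast
  then obtain q where q: "p = [:- \<mu>, 1:] * q"
    unfolding poly_eq_0_iff_dvd by (elim dvdE)
  then have "q \<noteq> 0" using Suc.prems(1) by auto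
  then have "degree q = n" using Suc.hyps(2) unfolding q by (subst (asm) degree_mult_eq) auto
  moreover have "poly_act A q (A *v v - \<mu> *s v) = 0"
    using Suc.prems(2) by (simp only: q poly_act_linear_factor)
  ultimately obtain F f where F: "finite F" and f: "\<And>l. A *v f l = l *s f l"
    and v: "A *v v - \<mu> *s v = (\<Sum>l\<in>F. f l)"
    using Suc.hyps(1) \<open>q \<noteq> 0\<close> by blast
  define g where "g = (\<lambda>l. inverse (l - \<mu>) *s f l)"
  define w where "w = (\<Sum>l\<in>F - {\<mu>}. g l)"
  define u where "u = (if \<mu> \<in> F then f \<mu> else 0)"
  have g: "A *v g l = l *s g l" for l
    by (simp add: g_def vector_scalar_commute f vector_smult_assoc mult.commute)
  have "A *v w - \<mu> *s w = (\<Sum>l\<in>F - {\<mu>}. (l - \<mu>) *s g l)"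
    by (simp add: w_def vec.linear_sum[OF matrix_vector_mul_linear_gen] g vec.scale_sum_right
        sum_subtractf vector_sub_rdistrib)
  also have "\<dots> = (\<Sum>l\<in>F - {\<mu>}. f l)"
    by (intro sum.cong) (auto simp: g_def vector_smult_assoc)
  finally have w: "A *v w = \<mu> *s w + (\<Sum>l\<in>F - {\<mu>}. f l)"
    by (simp add: algebra_simps)
  have "(\<Sum>l\<in>F. f l) = u + (\<Sum>l\<in>F - {\<mu>}. f l)"
    using F by (auto simp: u_def sum.remove)
  then have x: "A *v (v - w) = \<mu> *s (v - w) + u"
    using v w by (simp add: matrix_vector_mult_diff_distrib vector_ssub_ldistrib algebra_simps)
  moreover have "A *v u = \<mu> *s u" by (simp add: u_def f)
  ultimately have "u = 0" using semisimple by blast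
  define h where "h = (\<lambda>l. if l = \<mu> then v - w else g l)"
  have "A *v h l = l *s h l" for l
    using x \<open>u = 0\<close> g by (simp add: h_def)
  moreover have "v = (\<Sum>l\<in>insert \<mu> F. h l)"
  proof -
    have "(\<Sum>l\<in>insert \<mu> F. h l) = h \<mu> + (\<Sum>l\<in>F - {\<mu>}. h l)"
      using F by (simp add: sum.insert_remove)
    also have "(\<Sum>l\<in>F - {\<mu>}. h l) = w" by (simp add: w_def h_def)
    finally show ?thesis by (simp add: h_def)
  qed
  ultimately show ?case using F by (intro exI[of _ "insert \<mu> F"] exI[of _ h]) simp
qed

section \<open>The Hermitian extension of the symplectic form\<close>

lemma symplectic_form_complex_add_left:
  "symplectic_form_complex (u + w) v = symplectic_form_complex u v + symplectic_form_complex w v"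
  by (simp add: symplectic_form_complex_def sum.distrib[symmetric] algebra_simps)

lemma symplectic_form_complex_skew:
  "symplectic_form_complex v u = - cnj (symplectic_form_complex u v)"
  by (simp add: symplectic_form_complex_def sum_negf[symmetric] algebra_simps)

lemma symplectic_form_complex_add_right:
  "symplectic_form_complex v (u + w) = symplectic_form_complex v u + symplectic_form_complex v w"
  by (simp add: symplectic_form_complex_def sum.distrib[symmetric] algebra_simps)

lemma symplectic_form_complex_scale_left:
  "symplectic_form_complex (c *s u) v = c * symplectic_form_complex u v"
  by (simp add: symplectic_form_complex_def sum_distrib_left algebra_simps)

lemma symplectic_form_complex_scale_right:
  "symplectic_form_complex u (c *s v) = cnj c * symplectic_form_complex u v"
  by (simp add: symplectic_form_complex_def sum_distrib_left algebra_simps)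

lemma symplectic_form_complex_zero [simp]:
  "symplectic_form_complex 0 v = 0" "symplectic_form_complex v 0 = 0"
  by (simp_all add: symplectic_form_complex_def)

lemma symplectic_form_complex_sum_left:
  "symplectic_form_complex (\<Sum>i\<in>I. f i) v = (\<Sum>i\<in>I. symplectic_form_complex (f i) v)"
  by (induction I rule: infinite_finite_induct) (simp_all add: symplectic_form_complex_add_left)

lemma symplectic_form_complex_sum_right:
  "symplectic_form_complex v (\<Sum>i\<in>I. f i) = (\<Sum>i\<in>I. symplectic_form_complex v (f i))"
  by (induction I rule: infinite_finite_induct) (simp_all add: symplectic_form_complex_add_right)

lemma Re_symplectic_form_complex_self [simp]: "Re (symplectic_form_complex u u) = 0"
  using symplectic_form_complex_skew[of u u] by (simp add: complex_eq_iff)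

lemma Re_krein_form: "Re (krein_form u v) = Im (symplectic_form_complex u v)"
  by (simp add: krein_form_def)

definition Re_vec :: "complex^'m \<Rightarrow> real^'m" where "Re_vec u = (\<chi> i. Re (u $ i))"
definition Im_vec :: "complex^'m \<Rightarrow> real^'m" where "Im_vec u = (\<chi> i. Im (u $ i))"
definition cnj_vec :: "complex^'m \<Rightarrow> complex^'m" where "cnj_vec u = (\<chi> i. cnj (u $ i))"

lemma Re_vec_complexify: "Re_vec (complexify W *v u) = W *v Re_vec u"
  by (simp add: Re_vec_def complexify_def matrix_vector_mult_def vec_eq_iff)

lemma Im_vec_complexify: "Im_vec (complexify W *v u) = W *v Im_vec u"
  by (simp add: Im_vec_def complexify_def matrix_vector_mult_def vec_eq_iff)

lemma complexify_cnj_vec: "complexify W *v cnj_vec u = cnj_vec (complexify W *v u)"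
  by (simp add: cnj_vec_def complexify_def matrix_vector_mult_def vec_eq_iff)

lemma cnj_vec_scale: "cnj_vec (c *s u) = cnj c *s cnj_vec u"
  by (simp add: cnj_vec_def vec_eq_iff)

lemma cnj_vec_eq_0 [simp]: "cnj_vec u = 0 \<longleftrightarrow> u = 0"
  by (simp add: cnj_vec_def vec_eq_iff)

lemma Re_Im_vec_eq_0: "Re_vec u = 0 \<and> Im_vec u = 0 \<longleftrightarrow> u = 0"
  by (auto simp: Re_vec_def Im_vec_def vec_eq_iff complex_eq_iff)

lemma symplectic_form_complex_cnj_vec:
  "symplectic_form_complex (cnj_vec u) (cnj_vec v) = cnj (symplectic_form_complex u v)"
  by (simp add: symplectic_form_complex_def cnj_vec_def)

lemma Re_symplectic_form_complex:
  "Re (symplectic_form_complex u v) =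
    symplectic_form (Re_vec u) (Re_vec v) + symplectic_form (Im_vec u) (Im_vec v)"
  by (simp add: symplectic_form_complex_def symplectic_form_def Re_vec_def Im_vec_def
      sum.distrib[symmetric] algebra_simps)

lemma Im_symplectic_form_complex:
  "Im (symplectic_form_complex u v) =
    symplectic_form (Im_vec u) (Re_vec v) - symplectic_form (Re_vec u) (Im_vec v)"
  by (simp add: symplectic_form_complex_def symplectic_form_def Re_vec_def Im_vec_def
      sum_subtractf[symmetric] algebra_simps)

lemma symplectic_form_complex_invariant:
  assumes "W \<in> Sp"
  shows "symplectic_form_complex (complexify W *v u) (complexify W *v v) = symplectic_form_complex u v"
  using assms by (simp add: complex_eq_iff Re_symplectic_form_complex Im_symplectic_form_complex
      Re_vec_complexify Im_vec_complexify Sp_def)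

text \<open>Invariance gives \<open>\<omega>(u, v) = \<omega>(W u, W v) = \<mu> \<cdot> cnj \<nu> \<cdot> \<omega>(u, v)\<close>. For eigenvalues on the unit
  circle the hypothesis on the product says that they differ; with \<open>u = v\<close> it forces the
  eigenvalue of a non-isotropic eigenvector to lie on the circle.\<close>

lemma eigenvectors_orthogonal:
  assumes W: "W \<in> Sp" and u: "complexify W *v u = \<mu> *s u" and v: "complexify W *v v = \<nu> *s v"
    and "\<mu> * cnj \<nu> \<noteq> 1"
  shows "symplectic_form_complex u v = 0"
  using symplectic_form_complex_invariant[OF W, of u v] assms mult.commute[of \<mu> "cnj \<nu>"]
  by (simp add: symplectic_form_complex_scale_left symplectic_form_complex_scale_right)

text \<open>This is what excludes Jordan blocks: expanding \<open>\<omega>(W u, W w) = \<omega>(u, w)\<close> leaves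
  \<open>\<mu> \<omega>(u, u) = 0\<close>.\<close>

lemma jordan_block_isotropic:
  assumes W: "W \<in> Sp" and u: "complexify W *v u = \<mu> *s u"
    and w: "complexify W *v w = \<mu> *s w + u" and \<mu>: "norm \<mu> = 1"
  shows "symplectic_form_complex u u = 0"
proof -
  have 1: "\<mu> * cnj \<mu> = 1" using \<mu> complex_norm_square[of \<mu>] by simp
  have "symplectic_form_complex u w = symplectic_form_complex (\<mu> *s u) (\<mu> *s w + u)"
    using symplectic_form_complex_invariant[OF W, of u w] u w by simp
  also have "\<dots> = (\<mu> * cnj \<mu>) * symplectic_form_complex u w + \<mu> * symplectic_form_complex u u"
    by (simp add: symplectic_form_complex_add_right symplectic_form_complex_scale_left
        symplectic_form_complex_scale_right)
  finally show ?thesis using 1 \<mu> by auto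
qed

section \<open>Positive ellipticity as positivity of a real quadratic form\<close>

text \<open>The link between the two descriptions of positive ellipticity: the left-hand side is the value
  of the real quadratic form \<open>\<omega>(u, W u)\<close>, extended to complex vectors, and the right-hand side is
  what the Krein condition controls.\<close>

lemma Re_form_eigenvector:
  assumes "complexify W *v u = \<mu> *s u"
  shows "Re (symplectic_form_complex u (complexify W *v u)) = Im \<mu> * Re (krein_form u u)"
  using assms by (simp add: symplectic_form_complex_scale_right Re_krein_form)

text \<open>For a rotation \<open>W = exp(\<theta> J)\<close> of a plane the condition reads \<open>sin \<theta> > 0\<close>. This set is shown
  to equal \<open>Sp_ell_pos\<close>.\<close>

definition Sp_pos :: "'n::finite mat2n set" where
  "Sp_pos = {W \<in> Sp. \<forall>u. u \<noteq> 0 \<longrightarrow> 0 < symplectic_form u (W *v u)}"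

lemma Sp_pos_complex:
  assumes W: "W \<in> Sp_pos" and "u \<noteq> 0"
  shows "0 < Re (symplectic_form_complex u (complexify W *v u))"
proof -
  have nonneg: "0 \<le> symplectic_form a (W *v a)" for a
    using W by (cases "a = 0") (auto simp: Sp_pos_def symplectic_form.zero_left less_imp_le)
  have "Re_vec u \<noteq> 0 \<or> Im_vec u \<noteq> 0" using assms(2) Re_Im_vec_eq_0 by blast
  then show ?thesis
    using W nonneg[of "Re_vec u"] nonneg[of "Im_vec u"]
    by (auto simp: Re_symplectic_form_complex Re_vec_complexify Im_vec_complexify Sp_pos_def
        intro: add_pos_nonneg add_nonneg_pos)
qed

lemma Sp_pos_eigenvector:
  assumes W: "W \<in> Sp_pos" and u: "complexify W *v u = \<mu> *s u" "u \<noteq> 0"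
  shows "0 < Im \<mu> * Re (krein_form u u)" "norm \<mu> = 1"
proof -
  show pos: "0 < Im \<mu> * Re (krein_form u u)"
    using Sp_pos_complex[OF W u(2)] Re_form_eigenvector[OF u(1)] by simp
  then have "symplectic_form_complex u u \<noteq> 0" by (auto simp: Re_krein_form)
  then have "\<mu> * cnj \<mu> = 1"
    using eigenvectors_orthogonal[OF _ u(1) u(1)] W by (auto simp: Sp_pos_def)
  then show "norm \<mu> = 1"
    by (metis complex_mod_sqrt_Re_mult_cnj one_complex.simps(1) real_sqrt_one)
qed

lemma Sp_pos_generalised_eigenspace:
  assumes W: "W \<in> Sp_pos" and v: "v \<in> generalised_eigenspace W \<mu>"
  shows "complexify W *v v = \<mu> *s v"
proof -
  let ?N = "\<lambda>u. complexify W *v u - \<mu> *s u"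
  have step: "?N w = 0" if "?N (?N w) = 0" for w
  proof (rule ccontr)
    assume nz: "?N w \<noteq> 0"
    have eig: "complexify W *v ?N w = \<mu> *s ?N w" using that by simp
    have "symplectic_form_complex (?N w) (?N w) = 0"
      by (rule jordan_block_isotropic[OF _ eig, of w]) (use W Sp_pos_eigenvector(2)[OF W eig nz] in \<open>auto simp: Sp_pos_def\<close>)
    then show False
      using Sp_pos_eigenvector(1)[OF W eig nz] by (simp add: Re_krein_form)
  qed
  obtain k where "(?N ^^ k) v = 0" using v by (auto simp: generalised_eigenspace_def)
  then have "?N v = 0"
  proof (induction k arbitrary: v)
    case 0 then show ?case by simp
  next
    case (Suc k)
    have "(?N ^^ k) (?N v) = 0" using Suc.prems by (simp only: funpow_Suc_right o_apply)
    then have "?N (?N v) = 0" by (rule Suc.IH)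
    then show ?case by (rule step)
  qed
  then show ?thesis by simp
qed

lemma eigenvector_in_generalised_eigenspace:
  "complexify W *v v = \<mu> *s v \<Longrightarrow> v \<in> generalised_eigenspace W \<mu>"
  unfolding generalised_eigenspace_def by (auto intro!: exI[of _ 1])

lemma Sp_pos_subset_Sp_ell_pos: "(Sp_pos :: 'n::finite mat2n set) \<subseteq> Sp_ell_pos"
proof
  fix W :: "'n mat2n" assume W: "W \<in> Sp_pos"
  have "\<mu> \<in> sphere 0 1 - {1, -1} \<and>
     (krein_positive_definite_on (generalised_eigenspace W \<mu>) \<longleftrightarrow> 0 < Im \<mu>)"
    if eig: "complex_eigenvalue W \<mu>" for \<mu>
  proof -
    obtain u where u: "complexify W *v u = \<mu> *s u" "u \<noteq> 0"
      using eig by (auto simp: complex_eigenvalue_def)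
    note pos = Sp_pos_eigenvector[OF W u]
    have "krein_positive_definite_on (generalised_eigenspace W \<mu>) \<longleftrightarrow> 0 < Im \<mu>"
    proof
      assume "krein_positive_definite_on (generalised_eigenspace W \<mu>)"
      then have "0 < Re (krein_form u u)"
        using u eigenvector_in_generalised_eigenspace
        by (auto simp: krein_positive_definite_on_def)
      then show "0 < Im \<mu>" using pos(1) by (simp add: zero_less_mult_iff)
    next
      assume Im: "0 < Im \<mu>"
      have "0 < Re (krein_form v v)" if v: "v \<in> generalised_eigenspace W \<mu>" "v \<noteq> 0" for v
        using Sp_pos_eigenvector(1)[OF W Sp_pos_generalised_eigenspace[OF W v(1)] v(2)] Im
        by (simp add: zero_less_mult_iff)
      then show "krein_positive_definite_on (generalised_eigenspace W \<mu>)"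
        by (simp add: krein_positive_definite_on_def)
    qed
    then show ?thesis using pos by auto
  qed
  then show "W \<in> Sp_ell_pos" using W by (auto simp: Sp_ell_pos_def Sp_pos_def)
qed

text \<open>The definition of \<open>Sp_ell_pos\<close> only says that \<open>\<kappa>\<close> is not positive definite on \<open>E\<^sub>\<mu>\<close> when
  \<open>Im \<mu> < 0\<close>. That \<open>\<kappa>\<close> is in fact negative there follows from complex conjugation, which exchanges
  \<open>E\<^sub>\<mu>\<close> with the eigenspace of \<open>cnj \<mu>\<close> and changes the sign of \<open>\<kappa>\<close>.\<close>

lemma Sp_ell_pos_eigenvector:
  assumes W: "W \<in> Sp_ell_pos" and u: "complexify W *v u = \<mu> *s u" "u \<noteq> 0"
  shows "0 < Im \<mu> * Re (krein_form u u)" "norm \<mu> = 1"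
proof -
  have ell: "norm \<nu> = 1 \<and> Im \<nu> \<noteq> 0 \<and> (0 < Im \<nu> \<longrightarrow> 0 < Re (krein_form w w))"
    if w: "complexify W *v w = \<nu> *s w" "w \<noteq> 0" for \<nu> w
  proof -
    have "complex_eigenvalue W \<nu>" using w by (auto simp: complex_eigenvalue_def)
    then have *: "norm \<nu> = 1" "\<nu> \<noteq> 1" "\<nu> \<noteq> - 1"
      "0 < Im \<nu> \<longrightarrow> krein_positive_definite_on (generalised_eigenspace W \<nu>)"
      using W by (auto simp: Sp_ell_pos_def)
    have "Im \<nu> \<noteq> 0"
    proof
      assume "Im \<nu> = 0"
      then have "\<bar>Re \<nu>\<bar> = 1" using *(1) by (simp add: cmod_eq_Re)
      then show False using *(2,3) \<open>Im \<nu> = 0\<close> by (auto simp: complex_eq_iff abs_if split: if_splits)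
    qed
    then show ?thesis
      using * w eigenvector_in_generalised_eigenspace[OF w(1)]
      by (auto simp: krein_positive_definite_on_def)
  qed
  show "norm \<mu> = 1" using ell[OF u] by simp
  show "0 < Im \<mu> * Re (krein_form u u)"
  proof (cases "0 < Im \<mu>")
    case True then show ?thesis using ell[OF u] by simp
  next
    case False
    have "complexify W *v cnj_vec u = cnj \<mu> *s cnj_vec u"
      by (simp add: complexify_cnj_vec u cnj_vec_scale)
    from ell[OF this] False ell[OF u] u(2)
    have "Im \<mu> < 0" "0 < Re (krein_form (cnj_vec u) (cnj_vec u))" by auto
    then show ?thesis
      by (simp add: Re_krein_form symplectic_form_complex_cnj_vec mult_neg_neg)
  qed
qed

text \<open>Decompose a vector into eigenvectors. By orthogonality the mixed terms of \<open>Re \<omega>(v, W v)\<close>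
  vanish, and each diagonal term is positive.\<close>

lemma Sp_ell_pos_subset_Sp_pos: "(Sp_ell_pos :: 'n::finite mat2n set) \<subseteq> Sp_pos"
proof
  fix W :: "'n mat2n" assume W: "W \<in> Sp_ell_pos"
  then have Sp: "W \<in> Sp" by (simp add: Sp_ell_pos_def)
  let ?A = "complexify W"
  have semisimple: "u = 0" if eq: "?A *v u = \<mu> *s u" "?A *v w = \<mu> *s w + u" for \<mu> u w
  proof (rule ccontr)
    assume "u \<noteq> 0"
    note pos = Sp_ell_pos_eigenvector[OF W eq(1) this]
    show False using jordan_block_isotropic[OF Sp eq pos(2)] pos(1) by (simp add: Re_krein_form)
  qed
  have "0 < Re (symplectic_form_complex v (?A *v v))" if "v \<noteq> 0" for v
  proof -
    obtain p where p: "p \<noteq> 0" "poly_act ?A p v = 0" by (rule exists_annihilating_poly)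
    have "\<exists>F f. finite F \<and> (\<forall>\<mu>. ?A *v f \<mu> = \<mu> *s f \<mu>) \<and> v = (\<Sum>\<mu>\<in>F. f \<mu>)"
      by (rule poly_act_eq_0_imp_sum_eigenvectors[OF _ p]) (erule (1) semisimple)
    then obtain F f where F: "finite F" and f: "\<And>\<mu>. ?A *v f \<mu> = \<mu> *s f \<mu>"
      and v: "v = (\<Sum>\<mu>\<in>F. f \<mu>)"
      by blast
    have orth: "symplectic_form_complex (f \<mu>) (?A *v f \<nu>) = 0" if "\<mu> \<noteq> \<nu>" for \<mu> \<nu>
    proof (cases "f \<mu> = 0 \<or> f \<nu> = 0")
      case True then show ?thesis by auto
    next
      case False
      then have "norm \<nu> = 1" using Sp_ell_pos_eigenvector[OF W f] by blast
      then have "\<nu> * cnj \<nu> = 1" using complex_norm_square[of \<nu>] by simp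
      then have "\<mu> * cnj \<nu> \<noteq> 1"
        using \<open>\<mu> \<noteq> \<nu>\<close> by (metis mult_cancel_right mult_zero_right zero_neq_one)
      then show ?thesis
        using eigenvectors_orthogonal[OF Sp f f] by (simp add: f symplectic_form_complex_scale_right)
    qed
    have pos: "f \<mu> \<noteq> 0 \<Longrightarrow> 0 < Re (symplectic_form_complex (f \<mu>) (?A *v f \<mu>))" for \<mu>
      using Sp_ell_pos_eigenvector(1)[OF W f] by (simp add: Re_form_eigenvector[OF f])
    have "symplectic_form_complex v (?A *v v) =
        (\<Sum>\<mu>\<in>F. \<Sum>\<nu>\<in>F. symplectic_form_complex (f \<mu>) (?A *v f \<nu>))"
      unfolding v by (simp add: symplectic_form_complex_sum_left symplectic_form_complex_sum_right
          vec.linear_sum[OF matrix_vector_mul_linear_gen]) (rule sum.swap)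
    also have "\<dots> = (\<Sum>\<mu>\<in>F. \<Sum>\<nu>\<in>F. if \<mu> = \<nu> then symplectic_form_complex (f \<mu>) (?A *v f \<mu>) else 0)"
      by (intro sum.cong) (auto simp: orth)
    also have "\<dots> = (\<Sum>\<mu>\<in>F. symplectic_form_complex (f \<mu>) (?A *v f \<mu>))"
      using F by simp
    finally have eq: "Re (symplectic_form_complex v (?A *v v)) =
        (\<Sum>\<mu>\<in>F. Re (symplectic_form_complex (f \<mu>) (?A *v f \<mu>)))" by simp
    obtain \<mu> where "\<mu> \<in> F" "f \<mu> \<noteq> 0" using \<open>v \<noteq> 0\<close> v by (metis sum.neutral)
    moreover have "0 \<le> Re (symplectic_form_complex (f \<mu>) (?A *v f \<mu>))" for \<mu>
      using pos[of \<mu>] by (cases "f \<mu> = 0") auto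
    ultimately show ?thesis
      unfolding eq using F pos by (intro sum_pos2) auto
  qed
  note pos = this
  have "0 < symplectic_form u (W *v u)" if "u \<noteq> 0" for u
  proof -
    \<comment> \<open>A real vector is a complex vector without imaginary part.\<close>
    define v :: "complex^('n+'n)" where "v = (\<chi> i. complex_of_real (u $ i))"
    have "Re_vec v = u" "Im_vec v = 0" by (simp_all add: v_def Re_vec_def Im_vec_def vec_eq_iff)
    moreover from this that have "v \<noteq> 0" using Re_Im_vec_eq_0 by fastforce
    ultimately show ?thesis
      using pos[of v]
      by (simp add: Re_symplectic_form_complex Re_vec_complexify Im_vec_complexify symplectic_form.zero_left)
  qed
  then show "W \<in> Sp_pos" using Sp by (simp add: Sp_pos_def)
qed

section \<open>The Cayley transform\<close>

text \<open>These \<open>X\<close> form the interior of the cone of positive semidefinite forms in \<open>sp_algebra\<close>; they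
  take the place of the positively elliptic region in the linear picture.\<close>

definition sp_cone_interior :: "'n::finite mat2n set" where
  "sp_cone_interior = {X \<in> sp_algebra. \<forall>u. u \<noteq> 0 \<longrightarrow> 0 < symplectic_form u (X *v u)}"

text \<open>This is \<open>(W - 1) (W + 1)\<^sup>-\<^sup>1\<close>, written with a single inverse so that its derivative follows from
  that of matrix inversion; likewise \<open>inv_cayley X\<close> is \<open>(1 + X) (1 - X)\<^sup>-\<^sup>1\<close>.\<close>

definition cayley :: "'n::finite mat2n \<Rightarrow> 'n mat2n" where
  "cayley W = mat 1 - 2 *\<^sub>R matrix_inv (W + mat 1)"

definition inv_cayley :: "'n::finite mat2n \<Rightarrow> 'n mat2n" where
  "inv_cayley X = 2 *\<^sub>R matrix_inv (mat 1 - X) - mat 1"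

text \<open>If \<open>W u = - u\<close>, then \<open>\<omega>(u, W u) = 0\<close>, so \<open>u = 0\<close>. The same argument shows that \<open>1\<close> is not an
  eigenvalue of a matrix in \<open>sp_cone_interior\<close>.\<close>

lemma Sp_pos_invertible: "W \<in> Sp_pos \<Longrightarrow> invertible (W + mat 1)"
proof (rule invertible_if_ker_0)
  fix u assume W: "W \<in> Sp_pos" and "(W + mat 1) *v u = 0"
  then have "W *v u = - u"
    by (simp add: mat_vec.add_left eq_neg_iff_add_eq_0)
  then have "symplectic_form u (W *v u) = 0" by (simp add: symplectic_form.minus_right)
  then show "u = 0" using W by (force simp: Sp_pos_def)
qed

lemma sp_cone_interior_invertible: "X \<in> sp_cone_interior \<Longrightarrow> invertible (mat 1 - X)"
proof (rule invertible_if_ker_0)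
  fix u assume X: "X \<in> sp_cone_interior" and "(mat 1 - X) *v u = 0"
  then have "X *v u = u" by (simp add: mat_vec.diff_left)
  then have "symplectic_form u (X *v u) = 0" by simp
  then show "u = 0" using X by (force simp: sp_cone_interior_def)
qed

lemma inv_cayley_cayley: "W \<in> Sp_pos \<Longrightarrow> inv_cayley (cayley W) = W"
proof -
  assume "W \<in> Sp_pos"
  then have "invertible (W + mat 1)" by (rule Sp_pos_invertible)
  then have "matrix_inv (2 *\<^sub>R matrix_inv (W + mat 1)) = (1/2) *\<^sub>R (W + mat 1)"
    by (intro matrix_inv_eq) (simp add: mat_mult.scaleR_left mat_mult.scaleR_right matrix_inv_mult)
  then show ?thesis by (simp add: inv_cayley_def cayley_def)
qed

lemma matrix_inv_inv_cayley:
  assumes "X \<in> sp_cone_interior"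
  shows "matrix_inv (inv_cayley X + mat 1) = (1/2) *\<^sub>R (mat 1 - X)"
  using sp_cone_interior_invertible[OF assms]
  by (intro matrix_inv_eq)
    (simp add: inv_cayley_def mat_mult.scaleR_left mat_mult.scaleR_right matrix_inv_mult)

lemma cayley_inv_cayley: "X \<in> sp_cone_interior \<Longrightarrow> cayley (inv_cayley X) = X"
  by (simp add: cayley_def matrix_inv_inv_cayley)

text \<open>With \<open>v = (W + 1) u\<close> we have \<open>X v = (W - 1) u\<close>. Invariance of \<open>\<omega>\<close> cancels the terms
  \<open>\<omega>(W u, W u')\<close> and \<open>\<omega>(u, u')\<close>, and what remains is the symmetrisation of \<open>\<omega>(u, W u')\<close>.\<close>

lemma cayley_in_sp_cone_interior:
  assumes W: "W \<in> Sp_pos" shows "cayley W \<in> sp_cone_interior"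
proof -
  have Sp: "symplectic_form (W *v u) (W *v v) = symplectic_form u v" for u v
    using W by (simp add: Sp_pos_def Sp_def)
  have inv: "invertible (W + mat 1)" using W by (rule Sp_pos_invertible)
  have act: "cayley W *v ((W + mat 1) *v u) = W *v u - u" for u
  proof -
    have "matrix_inv (W + mat 1) *v ((W + mat 1) *v u) = u"
      using inv by (simp add: matrix_vector_mul_assoc matrix_inv_mult)
    then have "cayley W *v ((W + mat 1) *v u) = (W + mat 1) *v u - 2 *\<^sub>R u"
      by (simp add: cayley_def mat_vec.diff_left mat_vec.scaleR_left)
    then show ?thesis by (simp add: mat_vec.add_left scaleR_2)
  qed
  have form: "symplectic_form ((W + mat 1) *v u) (cayley W *v ((W + mat 1) *v v)) =
      symplectic_form u (W *v v) + symplectic_form v (W *v u)" for u v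
    unfolding act using symplectic_form_skew[of v "W *v u"]
    by (simp add: mat_vec.add_left symplectic_form.add_left symplectic_form.diff_right Sp)
  have "symplectic_form v (cayley W *v w) = symplectic_form w (cayley W *v v)" for v w
    using invertible_surj[OF inv, of v] invertible_surj[OF inv, of w] form by (metis add.commute)
  moreover have "0 < symplectic_form v (cayley W *v v)" if "v \<noteq> 0" for v
  proof -
    obtain u where u: "v = (W + mat 1) *v u" using invertible_surj[OF inv] .
    then have "u \<noteq> 0" using that by auto
    then show ?thesis using W unfolding u form by (simp add: Sp_pos_def)
  qed
  ultimately show ?thesis by (simp add: sp_cone_interior_def sp_algebra_def)
qed

text \<open>With \<open>v = (1 - X) u\<close> we have \<open>W v = (1 + X) u\<close>, and \<open>1 - X\<close> and \<open>1 + X\<close> are adjoint with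
  respect to \<open>\<omega>\<close>.\<close>

lemma inv_cayley_in_Sp_pos:
  assumes X: "X \<in> sp_cone_interior" shows "inv_cayley X \<in> Sp_pos"
proof -
  have sp: "symplectic_form (X *v u) v = - symplectic_form u (X *v v)" for u v
    using X by (intro sp_algebra_skew) (simp add: sp_cone_interior_def)
  have inv: "invertible (mat 1 - X)" using X by (rule sp_cone_interior_invertible)
  have act: "inv_cayley X *v ((mat 1 - X) *v u) = u + X *v u" for u
  proof -
    have "matrix_inv (mat 1 - X) *v ((mat 1 - X) *v u) = u"
      using inv by (simp add: matrix_vector_mul_assoc matrix_inv_mult)
    then have "inv_cayley X *v ((mat 1 - X) *v u) = 2 *\<^sub>R u - (mat 1 - X) *v u"
      by (simp add: inv_cayley_def mat_vec.diff_left mat_vec.scaleR_left)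
    then show ?thesis by (simp add: mat_vec.diff_left scaleR_2)
  qed
  have "symplectic_form (inv_cayley X *v v) (inv_cayley X *v w) = symplectic_form v w" for v w
  proof -
    obtain u where u: "v = (mat 1 - X) *v u" using invertible_surj[OF inv] .
    obtain z where z: "w = (mat 1 - X) *v z" using invertible_surj[OF inv] .
    show ?thesis unfolding u z act
      by (simp add: mat_vec.diff_left symplectic_form.add_left symplectic_form.add_right
          symplectic_form.diff_left symplectic_form.diff_right sp)
  qed
  moreover have "0 < symplectic_form v (inv_cayley X *v v)" if "v \<noteq> 0" for v
  proof -
    obtain u where u: "v = (mat 1 - X) *v u" using invertible_surj[OF inv] .
    then have "u \<noteq> 0" using that by auto
    then have "0 < symplectic_form u (X *v u)" using X by (simp add: sp_cone_interior_def)
    then show ?thesis unfolding u act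
      by (simp add: mat_vec.diff_left symplectic_form.add_right symplectic_form.diff_left sp)
  qed
  ultimately show ?thesis by (simp add: Sp_pos_def Sp_def)
qed

text \<open>
  Up to the factor \<open>2\<close>, the matrix on the left is the derivative of the Cayley transform in the
  direction \<open>W A\<close>, and the right-hand side is the form of \<open>A\<close> pulled back along \<open>S\<close>. The reason is
  that \<open>S W = (1 + W\<^sup>-\<^sup>1)\<^sup>-\<^sup>1\<close> is the adjoint of \<open>S = (1 + W)\<^sup>-\<^sup>1\<close>.
\<close>

lemma cayley_differential_form:
  assumes W: "W \<in> Sp" and inv: "invertible (W + mat 1)"
  defines "S \<equiv> matrix_inv (W + mat 1)"
  shows "symplectic_form v ((S ** (W ** A) ** S) *v w) = symplectic_form (S *v v) (A *v (S *v w))"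
proof -
  let ?u = "S *v v" and ?z = "A *v (S *v w)"
  let ?y = "S *v (W *v ?z)"
  have Sp: "symplectic_form (W *v a) (W *v b) = symplectic_form a b" for a b
    using W by (simp add: Sp_def)
  have S: "(W + mat 1) *v (S *v a) = a" for a
    using inv by (simp add: S_def matrix_vector_mul_assoc matrix_inv_mult)
  have "symplectic_form v ?y = symplectic_form ((W + mat 1) *v ?u) ?y" by (simp add: S)
  also have "\<dots> = symplectic_form (W *v ?u) ?y + symplectic_form ?u ?y"
    by (simp add: mat_vec.add_left symplectic_form.add_left)
  also have "\<dots> = symplectic_form (W *v ?u) ((W + mat 1) *v ?y)"
    by (simp add: mat_vec.add_left symplectic_form.add_right Sp)
  also have "\<dots> = symplectic_form ?u ?z" by (simp add: S Sp)
  finally show ?thesis by (simp add: matrix_vector_mul_assoc matrix_mul_assoc)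
qed

lemma sp_cone_id_congruence:
  fixes A B S :: "'n::finite mat2n"
  assumes form: "\<And>v w. symplectic_form v (B *v w) = c * symplectic_form (S *v v) (A *v (S *v w))"
    and "c > 0" and S: "invertible S" and A: "A \<in> sp_cone_id"
  shows "B \<in> sp_cone_id"
proof -
  have "symplectic_form v (B *v w) = symplectic_form w (B *v v)" for v w
    using A by (simp add: form sp_cone_id_def sp_algebra_def)
  moreover have "0 \<le> symplectic_form v (B *v v)" for v
    using A \<open>c > 0\<close> by (simp add: form sp_cone_id_def)
  moreover have "B \<noteq> 0"
  proof
    assume "B = 0"
    have "symplectic_form v (A *v w) = 0" for v w
    proof -
      obtain u z where "v = S *v u" "w = S *v z" using invertible_surj[OF S] by metis
      then show ?thesis using form[of u z] \<open>B = 0\<close> \<open>c > 0\<close> by (simp add: symplectic_form.zero_right)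
    qed
    then show False using A matrix_eq_0_if_form_0 by (auto simp: sp_cone_id_def)
  qed
  ultimately show ?thesis by (simp add: sp_cone_id_def sp_algebra_def)
qed

lemma cayley_derivative_in_cone:
  assumes der: "(\<gamma> has_vector_derivative V) (at t within S)" and t: "t \<in> S"
    and \<gamma>: "\<And>s. s \<in> S \<Longrightarrow> \<gamma> s \<in> Sp_pos" and V: "V \<in> sp_cone (\<gamma> t)"
  shows "\<exists>B\<in>sp_cone_id. ((\<lambda>s. cayley (\<gamma> s)) has_vector_derivative B) (at t within S)"
proof -
  let ?R = "matrix_inv (\<gamma> t + mat 1)"
  obtain A where A: "A \<in> sp_cone_id" "V = \<gamma> t ** A" using V by (auto simp: sp_cone_def)
  have inv: "invertible (\<gamma> t + mat 1)" using \<gamma>[OF t] by (rule Sp_pos_invertible)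
  have "((\<lambda>s. \<gamma> s + mat 1) has_vector_derivative V) (at t within S)"
    using der by (auto intro!: derivative_eq_intros)
  then have "((\<lambda>s. matrix_inv (\<gamma> s + mat 1)) has_vector_derivative - (?R ** V ** ?R)) (at t within S)"
    using t \<gamma> by (intro has_vector_derivative_matrix_inv) (auto intro: Sp_pos_invertible)
  then have "((\<lambda>s. cayley (\<gamma> s)) has_vector_derivative 2 *\<^sub>R (?R ** V ** ?R)) (at t within S)"
    unfolding cayley_def by (auto intro!: derivative_eq_intros)
  moreover have "2 *\<^sub>R (?R ** V ** ?R) \<in> sp_cone_id"
  proof (rule sp_cone_id_congruence[OF _ _ _ A(1)])
    show "symplectic_form v ((2 *\<^sub>R (?R ** V ** ?R)) *v w) =
        2 * symplectic_form (?R *v v) (A *v (?R *v w))" for v w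
      using cayley_differential_form[OF _ inv, of v A w] \<gamma>[OF t]
      by (simp add: A(2) Sp_pos_def mat_vec.scaleR_left symplectic_form.scaleR_right)
    show "invertible ?R" using matrix_inv_mult[OF inv] by (auto simp: invertible_def)
  qed simp
  ultimately show ?thesis by blast
qed

text \<open>The matrix \<open>2 R D R\<close> is the velocity of \<open>inv_cayley X\<close> when \<open>X\<close> moves with velocity \<open>D\<close>. As
  the two transforms are inverse to each other, \<open>cayley_differential_form\<close> can be read backwards,
  with the congruence \<open>W + 1\<close> in place of its inverse.\<close>

lemma inv_cayley_derivative_in_cone:
  assumes X: "X \<in> sp_cone_interior" and D: "D \<in> sp_cone_id"
  defines "R \<equiv> matrix_inv (mat 1 - X)"
  shows "2 *\<^sub>R (R ** D ** R) \<in> sp_cone (inv_cayley X)"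
proof -
  define W where "W = inv_cayley X"
  define S where "S = matrix_inv (W + mat 1)"
  define A where "A = matrix_inv W ** (2 *\<^sub>R (R ** D ** R))"
  have W: "W \<in> Sp_pos" using X by (simp add: W_def inv_cayley_in_Sp_pos)
  then have Sp: "W \<in> Sp" and inv: "invertible (W + mat 1)"
    by (simp_all add: Sp_pos_def Sp_pos_invertible)
  have WA: "W ** A = 2 *\<^sub>R (R ** D ** R)"
    using matrix_inv_mult(1)[OF Sp_invertible[OF Sp]] by (simp add: A_def matrix_mul_assoc)
  have S: "S = (1/2) *\<^sub>R (mat 1 - X)"
    unfolding S_def W_def using X by (rule matrix_inv_inv_cayley)
  have "(mat 1 - X) ** R = mat 1" "R ** (mat 1 - X) = mat 1"
    using matrix_inv_mult[OF sp_cone_interior_invertible[OF X]] by (simp_all add: R_def)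
  then have "(mat 1 - X) ** (R ** D ** R) ** (mat 1 - X) = D"
    by (metis matrix_mul_assoc matrix_mul_lid matrix_mul_rid)
  then have SWS: "S ** (W ** A) ** S = (1/2) *\<^sub>R D"
    unfolding WA S by (simp add: mat_mult.scaleR_left mat_mult.scaleR_right)
  have "A \<in> sp_cone_id"
  proof (rule sp_cone_id_congruence[OF _ _ inv D])
    fix v w
    have S': "S *v ((W + mat 1) *v a) = a" for a
      using inv by (simp add: S_def matrix_vector_mul_assoc matrix_inv_mult)
    show "symplectic_form v (A *v w) =
        (1/2) * symplectic_form ((W + mat 1) *v v) (D *v ((W + mat 1) *v w))"
      using cayley_differential_form[OF Sp inv, of "(W + mat 1) *v v" A "(W + mat 1) *v w"]
      unfolding S_def[symmetric] SWS S'
      by (simp add: mat_vec.scaleR_left symplectic_form.scaleR_right)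
  qed simp
  then show ?thesis unfolding sp_cone_def W_def[symmetric] WA[symmetric] by blast
qed

section \<open>Causal curves and the Loewner order\<close>

definition loewner_le :: "'n::finite mat2n \<Rightarrow> 'n mat2n \<Rightarrow> bool" where
  "loewner_le X Y \<longleftrightarrow> (\<forall>v. symplectic_form v (X *v v) \<le> symplectic_form v (Y *v v))"

text \<open>
  Each function \<open>t \<mapsto> \<omega>(v, X(t) v)\<close> has a nonnegative derivative. If \<open>X\<close> had equal end points, all
  these functions would be constant; then the form of \<open>X'(a)\<close> would vanish on the diagonal, hence
  be zero, whereas the cone does not contain \<open>0\<close>.
\<close>

lemma causal_curve_imp_loewner_less:
  fixes \<gamma> :: "real \<Rightarrow> 'n::finite mat2n"
  assumes "causal_curve Sp_pos sp_cone \<gamma> a b"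
  shows "loewner_le (cayley (\<gamma> a)) (cayley (\<gamma> b))" "cayley (\<gamma> a) \<noteq> cayley (\<gamma> b)"
proof -
  have M: "\<gamma> t \<in> Sp_pos" if "t \<in> {a..b}" for t
    using assms that by (auto simp: causal_curve_def)
  have ab: "a < b" using assms by (simp add: causal_curve_def)
  have "\<exists>B\<in>sp_cone_id. ((\<lambda>s. cayley (\<gamma> s)) has_vector_derivative B) (at t within {a..b})"
    if t: "t \<in> {a..b}" for t
  proof -
    obtain G where "G (0::nat) = \<gamma>"
      "\<forall>k. \<forall>t\<in>{a..b}. (G k has_vector_derivative G (Suc k) t) (at t within {a..b})"
      using assms unfolding causal_curve_def smooth_curve_on_def by blast
    then have "(\<gamma> has_vector_derivative G (Suc 0) t) (at t within {a..b})"
      using t by metis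
    then have "\<gamma> differentiable at t within {a..b}"
      by (rule differentiableI_vector)
    then have "(\<gamma> has_vector_derivative vector_derivative \<gamma> (at t within {a..b})) (at t within {a..b})"
      by (simp add: vector_derivative_works)
    then show ?thesis
      using t M assms by (intro cayley_derivative_in_cone) (auto simp: causal_curve_def)
  qed
  then obtain B where B: "\<And>t. t \<in> {a..b} \<Longrightarrow> B t \<in> sp_cone_id"
    and der: "\<And>t. t \<in> {a..b} \<Longrightarrow>
      ((\<lambda>s. cayley (\<gamma> s)) has_vector_derivative B t) (at t within {a..b})"
    by metis
  define q where "q v t = symplectic_form v (cayley (\<gamma> t) *v v)" for v t
  have q: "(q v has_vector_derivative symplectic_form v (B t *v v)) (at t within {a..b})"
    if "t \<in> {a..b}" for v t
    unfolding q_def using der[OF that]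
    by (intro bounded_linear.has_vector_derivative[OF symplectic_form.bounded_linear_right]
        bounded_linear.has_vector_derivative[OF mat_vec.bounded_linear_left])
  have mono: "q v s \<le> q v t" if st: "a \<le> s" "s \<le> t" "t \<le> b" for v s t
  proof (cases "s = t")
    case False
    have "\<exists>x\<in>{s<..<t}. q v t - q v s = (t - s) *\<^sub>R symplectic_form v (B x *v v)"
    proof (rule mvt_simple)
      fix x assume "s \<le> x" "x \<le> t"
      then show "(q v has_derivative (\<lambda>h. h *\<^sub>R symplectic_form v (B x *v v))) (at x within {s..t})"
        using st by (intro has_derivative_subset[OF q[unfolded has_vector_derivative_def]]) auto
    qed (use st False in simp)
    then obtain x where "x \<in> {s<..<t}" "q v t - q v s = (t - s) *\<^sub>R symplectic_form v (B x *v v)"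
      by blast
    moreover from this have "0 \<le> symplectic_form v (B x *v v)"
      using B[of x] st by (auto simp: sp_cone_id_def)
    ultimately show ?thesis using st
      by (smt (verit) mult_nonneg_nonneg real_scaleR_def)
  qed simp
  then show "loewner_le (cayley (\<gamma> a)) (cayley (\<gamma> b))"
    using ab by (simp add: loewner_le_def q_def[symmetric])
  show "cayley (\<gamma> a) \<noteq> cayley (\<gamma> b)"
  proof
    assume "cayley (\<gamma> a) = cayley (\<gamma> b)"
    then have ends: "q v a = q v b" for v by (simp add: q_def)
    have a: "a \<in> {a..b}" using ab by simp
    have "symplectic_form v (B a *v v) = 0" for v
    proof -
      have const: "q v t = q v a" if "t \<in> {a..b}" for t
        using mono[of a t v] mono[of t b v] ends[of v] that by simp
      have "(q v has_vector_derivative 0) (at a within {a..b})"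
        by (rule has_vector_derivative_transform[OF a const has_vector_derivative_const])
      with q[OF a] show ?thesis
        by (rule vector_derivative_unique_within_closed_interval[OF ab a[folded cbox_interval],
            unfolded cbox_interval])
    qed
    then have "symplectic_form v (B a *v w) = 0" for v w
      using B[OF a] by (subst sp_algebra_polarisation) (auto simp: sp_cone_id_def)
    then show False using B[OF a] matrix_eq_0_if_form_0 by (auto simp: sp_cone_id_def)
  qed
qed

text \<open>The \<open>k\<close>-th derivative of the resolvent \<open>R\<close> along the segment \<open>P + t D\<close> is \<open>k! (R D)\<^sup>k R\<close>.\<close>

lemma smooth_resolvent_segment:
  fixes D :: "real^'n::finite^'n"
  assumes inv: "\<And>t. t \<in> {a..b} \<Longrightarrow> invertible (mat 1 - (P + t *\<^sub>R D))"
  defines "R \<equiv> \<lambda>t. matrix_inv (mat 1 - (P + t *\<^sub>R D))"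
  shows "smooth_curve_on R a b"
    and "\<And>t. t \<in> {a..b} \<Longrightarrow> (R has_vector_derivative R t ** D ** R t) (at t within {a..b})"
proof -
  show R: "(R has_vector_derivative R t ** D ** R t) (at t within {a..b})" if "t \<in> {a..b}" for t
  proof -
    have "((\<lambda>t. mat 1 - (P + t *\<^sub>R D)) has_vector_derivative - D) (at t within {a..b})"
      by (auto intro!: derivative_eq_intros)
    from has_vector_derivative_matrix_inv[OF this that inv] show ?thesis
      by (simp add: R_def mat_mult.minus_left mat_mult.minus_right)
  qed
  define F where "F = rec_nat R (\<lambda>k G t. real (k + 1) *\<^sub>R (G t ** D ** R t))"
  have F_0: "F 0 = R" and F_Suc: "\<And>k. F (Suc k) = (\<lambda>t. real (k + 1) *\<^sub>R (F k t ** D ** R t))"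
    by (simp_all add: F_def)
  have "(F k has_vector_derivative F (Suc k) t) (at t within {a..b})" if t: "t \<in> {a..b}" for k t
  proof (induction k)
    case 0
    then show ?case using R[OF t] by (simp add: F_Suc F_0)
  next
    case (Suc k)
    have "((\<lambda>t. F k t ** D) has_vector_derivative F (Suc k) t ** D) (at t within {a..b})"
      by (rule bounded_linear.has_vector_derivative[OF mat_mult.bounded_linear_left Suc.IH])
    from bounded_linear.has_vector_derivative[OF bounded_linear_scaleR_right
        mat_mult.has_vector_derivative[OF this R[OF t]], of "real (k + 1)"]
    have der: "(F (Suc k) has_vector_derivative real (k + 1) *\<^sub>R
        (F k t ** D ** (R t ** D ** R t) + F (Suc k) t ** D ** R t)) (at t within {a..b})"
      by (simp only: F_Suc[of k, symmetric])
    have "real (k + 1) *\<^sub>R (F k t ** D ** (R t ** D ** R t) + F (Suc k) t ** D ** R t) =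
        F (Suc (Suc k)) t"
    proof -
      define Z where "Z = F k t ** D ** (R t ** D ** R t)"
      have FZ: "F (Suc k) t ** D ** R t = real (k + 1) *\<^sub>R Z"
        by (simp only: F_Suc[of k] mat_mult.scaleR_left matrix_mul_assoc Z_def)
      have "Z + real (k + 1) *\<^sub>R Z = real (Suc k + 1) *\<^sub>R Z"
        using scaleR_add_left[of 1 "real (k + 1)" Z] by (simp add: add.commute)
      then show ?thesis
        unfolding F_Suc[of "Suc k"] FZ Z_def[symmetric]
        by (simp only: scaleR_scaleR mult.commute)
    qed
    with der show ?case by (rule subst[rotated])
  qed
  then show "smooth_curve_on R a b"
    unfolding smooth_curve_on_def using F_0 by (intro exI[of _ F]) simp
qed

text \<open>This passes from the resolvent to \<open>inv_cayley\<close>.\<close>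

lemma smooth_curve_on_scale_diff:
  assumes "smooth_curve_on \<gamma> a b"
  shows "smooth_curve_on (\<lambda>t. c *\<^sub>R \<gamma> t - d) a b"
proof -
  obtain G where G: "G 0 = \<gamma>" and
    der: "\<And>k t. t \<in> {a..b} \<Longrightarrow> (G k has_vector_derivative G (Suc k) t) (at t within {a..b})"
    using assms unfolding smooth_curve_on_def by blast
  define H where "H k t = c *\<^sub>R G k t - (if k = 0 then d else 0)" for k :: nat and t
  have "(H k has_vector_derivative H (Suc k) t) (at t within {a..b})" if "t \<in> {a..b}" for k t
    unfolding H_def using der[OF that, of k] by (auto intro!: derivative_eq_intros)
  moreover have "H 0 = (\<lambda>t. c *\<^sub>R \<gamma> t - d)" by (simp add: H_def G fun_eq_iff)
  ultimately show ?thesis unfolding smooth_curve_on_def by (intro exI[of _ H]) simp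
qed

lemma loewner_less_imp_causal_curve:
  fixes P Q :: "'n::finite mat2n"
  assumes P: "P \<in> sp_cone_interior" and Q: "Q \<in> sp_cone_interior" and le: "loewner_le P Q" and "P \<noteq> Q"
  shows "\<exists>\<gamma> a b. causal_curve Sp_pos sp_cone \<gamma> a b \<and> \<gamma> a = inv_cayley P \<and> \<gamma> b = inv_cayley Q"
proof -
  define D where "D = Q - P"
  define X where "X t = P + t *\<^sub>R D" for t
  define R where "R t = matrix_inv (mat 1 - X t)" for t
  have D: "D \<in> sp_cone_id"
    using P Q le \<open>P \<noteq> Q\<close>
    by (auto simp: D_def sp_cone_id_def sp_algebra_def sp_cone_interior_def loewner_le_def
        mat_vec.diff_left symplectic_form.diff_right)
  have X: "X t \<in> sp_cone_interior" if "0 \<le> t" for t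
    using that P D by (auto simp: X_def sp_cone_interior_def sp_algebra_def sp_cone_id_def mat_vec.add_left
        mat_vec.scaleR_left symplectic_form.add_right symplectic_form.scaleR_right
        intro!: add_pos_nonneg mult_nonneg_nonneg)
  have inv: "invertible (mat 1 - (P + t *\<^sub>R D))" if "t \<in> {0..1}" for t
    using sp_cone_interior_invertible[OF X[of t]] that by (simp add: X_def)
  have R_eq: "R = (\<lambda>t. matrix_inv (mat 1 - (P + t *\<^sub>R D)))" by (simp add: R_def X_def fun_eq_iff)
  have curve: "(\<lambda>t. inv_cayley (X t)) = (\<lambda>t. 2 *\<^sub>R R t - mat 1)"
    by (simp add: inv_cayley_def R_def)
  have "smooth_curve_on (\<lambda>t. inv_cayley (X t)) 0 1"
    unfolding curve R_eq by (intro smooth_curve_on_scale_diff smooth_resolvent_segment inv)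
  moreover have "vector_derivative (\<lambda>t. inv_cayley (X t)) (at t within {0..1}) \<in> sp_cone (inv_cayley (X t))"
    if t: "t \<in> {0..1}" for t
  proof -
    have "(R has_vector_derivative R t ** D ** R t) (at t within {0..1})"
      unfolding R_eq by (rule smooth_resolvent_segment(2)[OF inv t])
    then have "((\<lambda>t. inv_cayley (X t)) has_vector_derivative 2 *\<^sub>R (R t ** D ** R t)) (at t within {0..1})"
      unfolding curve by (auto intro!: derivative_eq_intros)
    then have "vector_derivative (\<lambda>t. inv_cayley (X t)) (at t within {0..1}) = 2 *\<^sub>R (R t ** D ** R t)"
      using t by (intro vector_derivative_within_cbox[of 0 1, unfolded cbox_interval]) auto
    then show ?thesis
      using inv_cayley_derivative_in_cone[OF X D, of t] t by (simp add: R_def)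
  qed
  ultimately have "causal_curve Sp_pos sp_cone (\<lambda>t. inv_cayley (X t)) 0 1"
    using X by (auto simp: causal_curve_def intro: inv_cayley_in_Sp_pos)
  then show ?thesis
    by (intro exI[of _ "\<lambda>t. inv_cayley (X t)"] exI[of _ 0] exI[of _ 1]) (simp add: X_def D_def)
qed

lemma causal_curve_between_iff:
  assumes "p \<in> Sp_pos" "q \<in> Sp_pos"
  shows "p = q \<or> (\<exists>\<gamma> a b. causal_curve Sp_pos sp_cone \<gamma> a b \<and> \<gamma> a = p \<and> \<gamma> b = q) \<longleftrightarrow>
    loewner_le (cayley p) (cayley q)"
proof
  assume "p = q \<or> (\<exists>\<gamma> a b. causal_curve Sp_pos sp_cone \<gamma> a b \<and> \<gamma> a = p \<and> \<gamma> b = q)"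
  then show "loewner_le (cayley p) (cayley q)"
  proof (elim disjE exE conjE)
    assume "p = q"
    then show ?thesis by (simp add: loewner_le_def)
  next
    fix \<gamma> a b assume "causal_curve Sp_pos sp_cone \<gamma> a b" "\<gamma> a = p" "\<gamma> b = q"
    then show ?thesis using causal_curve_imp_loewner_less(1) by blast
  qed
next
  assume le: "loewner_le (cayley p) (cayley q)"
  show "p = q \<or> (\<exists>\<gamma> a b. causal_curve Sp_pos sp_cone \<gamma> a b \<and> \<gamma> a = p \<and> \<gamma> b = q)"
  proof (cases "cayley p = cayley q")
    case True
    then have "inv_cayley (cayley p) = inv_cayley (cayley q)" by simp
    then show ?thesis using assms by (simp add: inv_cayley_cayley)
  next
    case False
    then show ?thesis
      using loewner_less_imp_causal_curve[OF cayley_in_sp_cone_interior cayley_in_sp_cone_interior le] assms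
      by (simp add: inv_cayley_cayley)
  qed
qed

lemma loewner_ge_in_sp_cone_interior:
  assumes "P \<in> sp_cone_interior" "X \<in> sp_algebra" "loewner_le P X"
  shows "X \<in> sp_cone_interior"
  unfolding sp_cone_interior_def
proof safe
  fix u :: "real^('a+'a)" assume "u \<noteq> 0"
  then have "0 < symplectic_form u (P *v u)" using assms(1) by (simp add: sp_cone_interior_def)
  also have "\<dots> \<le> symplectic_form u (X *v u)" using assms(3) by (simp add: loewner_le_def)
  finally show "0 < symplectic_form u (X *v u)" .
qed (rule assms(2))

lemma causal_diamond_eq:
  assumes p: "p \<in> Sp_pos" and q: "q \<in> Sp_pos"
  shows "causal_future Sp_pos sp_cone p \<inter> causal_past Sp_pos sp_cone q =
    inv_cayley ` {X \<in> sp_algebra. loewner_le (cayley p) X \<and> loewner_le X (cayley q)}"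
    (is "?J = inv_cayley ` ?K")
proof -
  have "r \<in> causal_future Sp_pos sp_cone p \<longleftrightarrow> r \<in> Sp_pos \<and> loewner_le (cayley p) (cayley r)" for r
    using causal_curve_between_iff[OF p, of r] p unfolding causal_future_def by auto
  moreover have "r \<in> causal_past Sp_pos sp_cone q \<longleftrightarrow> r \<in> Sp_pos \<and> loewner_le (cayley r) (cayley q)" for r
    using causal_curve_between_iff[OF _ q, of r] q unfolding causal_past_def by auto
  ultimately have "?J = {r \<in> Sp_pos. loewner_le (cayley p) (cayley r) \<and> loewner_le (cayley r) (cayley q)}"
    by auto
  also have "\<dots> = inv_cayley ` ?K"
  proof (intro equalityI subsetI)
    fix r assume r: "r \<in> {r \<in> Sp_pos. loewner_le (cayley p) (cayley r) \<and> loewner_le (cayley r) (cayley q)}"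
    then have "cayley r \<in> ?K" using cayley_in_sp_cone_interior[of r] by (simp add: sp_cone_interior_def)
    moreover have "r = inv_cayley (cayley r)" using r by (simp add: inv_cayley_cayley)
    ultimately show "r \<in> inv_cayley ` ?K" by blast
  next
    fix r assume "r \<in> inv_cayley ` ?K"
    then obtain X where X: "X \<in> ?K" "r = inv_cayley X" by blast
    then have "X \<in> sp_cone_interior" using loewner_ge_in_sp_cone_interior[OF cayley_in_sp_cone_interior[OF p]] by blast
    then show "r \<in> {r \<in> Sp_pos. loewner_le (cayley p) (cayley r) \<and> loewner_le (cayley r) (cayley q)}"
      using X by (simp add: inv_cayley_in_Sp_pos cayley_inv_cayley)
  qed
  finally show ?thesis .
qed

section \<open>Compactness and openness\<close>

lemma continuous_on_form_mult:
  "continuous_on S (\<lambda>X :: 'n::finite mat2n. symplectic_form u (X *v v))"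
  by (rule linear_continuous_on[OF
      bounded_linear_compose[OF symplectic_form.bounded_linear_right mat_vec.bounded_linear_left]])

text \<open>Every entry of \<open>X\<close> has the form \<open>\<omega>(e, X a)\<close>. By polarisation it is controlled by two values
  of the quadratic form of \<open>X\<close>, which lie between those of \<open>P\<close> and \<open>Q\<close>.\<close>

lemma compact_loewner_interval:
  fixes P Q :: "'n::finite mat2n"
  shows "compact {X \<in> sp_algebra. loewner_le P X \<and> loewner_le X Q}" (is "compact ?K")
proof -
  have "closed ?K"
  proof -
    have "?K = (\<Inter>u. \<Inter>v. {X. symplectic_form u (X *v v) = symplectic_form v (X *v u)}) \<inter>
        (\<Inter>v. {X. symplectic_form v (P *v v) \<le> symplectic_form v (X *v v)}) \<inter>
        (\<Inter>v. {X. symplectic_form v (X *v v) \<le> symplectic_form v (Q *v v)})"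
      by (auto simp: sp_algebra_def loewner_le_def)
    moreover have "closed \<dots>"
      by (intro closed_Int closed_INT ballI)
        (rule closed_Collect_eq closed_Collect_le; rule continuous_on_form_mult continuous_on_const)+
    ultimately show ?thesis by simp
  qed
  moreover have "bounded ?K"
  proof -
    let ?b = "\<lambda>w. \<bar>symplectic_form w (P *v w)\<bar> + \<bar>symplectic_form w (Q *v w)\<bar>"
    have q: "\<bar>symplectic_form w (X *v w)\<bar> \<le> ?b w" if "X \<in> ?K" for X w
    proof -
      have "symplectic_form w (P *v w) \<le> symplectic_form w (X *v w)"
        "symplectic_form w (X *v w) \<le> symplectic_form w (Q *v w)"
        using that by (auto simp: loewner_le_def)
      then show ?thesis by linarith
    qed
    have quarter: "\<bar>(x - y) / 4\<bar> \<le> \<bar>x\<bar> + \<bar>y\<bar>" for x y :: real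
      by (auto simp: abs_if field_simps)
    have "\<exists>e. \<forall>w :: real^('n+'n). symplectic_form e w = w $ i" for i
      by (rule symplectic_form_component[of i]) blast
    then have "\<forall>i. \<exists>e. \<forall>w :: real^('n+'n). symplectic_form e w = w $ i" ..
    from choice[OF this] obtain e
      where e: "symplectic_form (e i) w = w $ i" for i and w :: "real^('n+'n)" by blast
    define c where "c i j = ?b (e i + axis j 1) + ?b (e i - axis j 1)" for i j
    have c: "\<bar>X $ i $ j\<bar> \<le> c i j" if X: "X \<in> ?K" for X i j
    proof -
      let ?a = "axis j 1 :: real^('n+'n)"
      have "X $ i $ j = symplectic_form (e i) (X *v ?a)"
        by (simp add: e matrix_vector_mult_basis column_def)
      also have "\<dots> = (symplectic_form (e i + ?a) (X *v (e i + ?a)) -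
          symplectic_form (e i - ?a) (X *v (e i - ?a))) / 4"
        using X by (intro sp_algebra_polarisation) simp
      finally have "\<bar>X $ i $ j\<bar> \<le> \<bar>symplectic_form (e i + ?a) (X *v (e i + ?a))\<bar> +
          \<bar>symplectic_form (e i - ?a) (X *v (e i - ?a))\<bar>"
        by (simp only: quarter)
      also have "\<dots> \<le> c i j" unfolding c_def by (intro add_mono q[OF X])
      finally show ?thesis .
    qed
    have "norm X \<le> (\<Sum>i\<in>UNIV. \<Sum>j\<in>UNIV. c i j)" if "X \<in> ?K" for X
    proof -
      have "norm X \<le> (\<Sum>i\<in>UNIV. norm (X $ i))"
        unfolding norm_vec_def by (intro L2_set_le_sum) simp
      also have "\<dots> \<le> (\<Sum>i\<in>UNIV. \<Sum>j\<in>UNIV. \<bar>X $ i $ j\<bar>)"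
        by (intro sum_mono norm_le_l1_cart)
      also have "\<dots> \<le> (\<Sum>i\<in>UNIV. \<Sum>j\<in>UNIV. c i j)"
        using c[OF that] by (intro sum_mono)
      finally show ?thesis .
    qed
    then show ?thesis by (rule boundedI)
  qed
  ultimately show ?thesis by (simp add: compact_eq_bounded_closed)
qed

lemma compact_causal_diamond:
  assumes p: "p \<in> Sp_pos" and q: "q \<in> Sp_pos"
  shows "compact (causal_future Sp_pos sp_cone p \<inter> causal_past Sp_pos sp_cone q)"
  unfolding causal_diamond_eq[OF p q]
proof (rule compact_continuous_image[OF _ compact_loewner_interval])
  let ?K = "{X \<in> sp_algebra. loewner_le (cayley p) X \<and> loewner_le X (cayley q)}"
  have "invertible (mat 1 - X)" if "X \<in> ?K" for X
    using that loewner_ge_in_sp_cone_interior[OF cayley_in_sp_cone_interior[OF p]] sp_cone_interior_invertible by blast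
  then have "continuous_on ?K (\<lambda>X. matrix_inv (mat 1 - X))"
    by (intro continuous_on_compose2[OF continuous_on_matrix_inv]) (auto intro!: continuous_intros)
  then show "continuous_on ?K inv_cayley"
    unfolding inv_cayley_def by (intro continuous_intros)
qed

text \<open>The minimum \<open>m\<close> of \<open>\<omega>(u, W u)\<close> on the unit sphere is positive, and a perturbation of \<open>W\<close> by
  less than \<open>m / (k l)\<close> changes the values there by less than \<open>m\<close>, where \<open>k\<close> and \<open>l\<close> bound the
  norms of the bilinear maps \<open>\<omega>\<close> and \<open>(A, u) \<mapsto> A u\<close>.\<close>

lemma openin_Sp_pos: "openin (top_of_set Sp) (Sp_pos :: 'n::finite mat2n set)"
proof -
  let ?U = "{W :: 'n mat2n. \<forall>u. u \<noteq> 0 \<longrightarrow> 0 < symplectic_form u (W *v u)}"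
  have "open ?U"
    unfolding open_dist
  proof safe
    fix W :: "'n mat2n"
    assume W: "\<forall>u. u \<noteq> 0 \<longrightarrow> 0 < symplectic_form u (W *v u)"
    let ?S = "sphere 0 1 :: (real^('n+'n)) set"
    have "continuous_on ?S (\<lambda>u. symplectic_form u (W *v u))"
      by (intro symplectic_form.continuous_on mat_vec.continuous_on continuous_intros)
    then obtain u0 where u0: "u0 \<in> ?S"
      and min: "\<And>u. u \<in> ?S \<Longrightarrow> symplectic_form u0 (W *v u0) \<le> symplectic_form u (W *v u)"
      using continuous_attains_inf[of ?S "\<lambda>u. symplectic_form u (W *v u)"] by auto
    define m where "m = symplectic_form u0 (W *v u0)"
    have "u0 \<noteq> 0" using u0 by auto
    then have "m > 0" using W by (simp add: m_def)
    obtain k where k: "k > 0" "\<And>a b :: real^('n+'n). norm (symplectic_form a b) \<le> norm a * norm b * k"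
      using symplectic_form.pos_bounded by blast
    obtain l where l: "l > 0" "\<And>(A :: 'n mat2n) b. norm (A *v b) \<le> norm A * norm b * l"
      using mat_vec.pos_bounded by blast
    have "0 < symplectic_form u (V *v u)" if V: "dist V W < m / (k * l)" and "u \<noteq> 0" for V u
    proof -
      define w where "w = u /\<^sub>R norm u"
      have w: "norm w = 1" "u = norm u *\<^sub>R w" using \<open>u \<noteq> 0\<close> by (simp_all add: w_def)
      have "\<bar>symplectic_form w ((V - W) *v w)\<bar> \<le> norm ((V - W) *v w) * k"
        using k(2)[of w "(V - W) *v w"] w by simp
      also have "\<dots> \<le> (norm (V - W) * l) * k"
        using l(2)[of "V - W" w] k(1) w by (intro mult_right_mono) auto
      also have "\<dots> < m" using V k(1) l(1) by (simp add: dist_norm field_simps)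
      finally have "\<bar>symplectic_form w (V *v w) - symplectic_form w (W *v w)\<bar> < m"
        by (simp add: mat_vec.diff_left symplectic_form.diff_right)
      moreover have "m \<le> symplectic_form w (W *v w)" using min[of w] w by (simp add: m_def)
      ultimately have "0 < symplectic_form w (V *v w)" by linarith
      moreover have "symplectic_form u (V *v u) = norm u * (norm u * symplectic_form w (V *v w))"
        by (subst (1 2) w(2)) (simp only: mat_vec.scaleR_right symplectic_form.scaleR_left
            symplectic_form.scaleR_right real_scaleR_def)
      ultimately show ?thesis using \<open>u \<noteq> 0\<close> by simp
    qed
    then show "\<exists>e>0. \<forall>V. dist V W < e \<longrightarrow> V \<in> ?U"
      using \<open>m > 0\<close> k(1) l(1) by (intro exI[of _ "m / (k * l)"]) auto
  qed
  moreover have "Sp_pos = Sp \<inter> ?U" by (auto simp: Sp_pos_def)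
  ultimately show ?thesis unfolding openin_open by blast
qed

theorem theorem1p1:
  shows "openin (top_of_set (Sp :: 'n::finite mat2n set)) Sp_ell_pos \<and>
         globally_hyperbolic (Sp_ell_pos :: 'n mat2n set) sp_cone"
proof -
  have eq: "(Sp_ell_pos :: 'n mat2n set) = Sp_pos"
    using Sp_pos_subset_Sp_ell_pos Sp_ell_pos_subset_Sp_pos by blast
  have "causal (Sp_pos :: 'n mat2n set) sp_cone"
    unfolding causal_def
  proof safe
    fix \<gamma> :: "real \<Rightarrow> 'n mat2n" and a b
    assume "causal_curve Sp_pos sp_cone \<gamma> a b" and closed: "\<gamma> a = \<gamma> b"
    from causal_curve_imp_loewner_less(2)[OF this(1)] show False by (simp add: closed)
  qed
  then show ?thesis
    unfolding eq globally_hyperbolic_def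
    by (simp add: openin_Sp_pos compact_causal_diamond)
qed

end
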